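(* Let $m<k$ be positive integers with $\gcd(m,k)=1$, let $t\ge 2$ be an integer, and let $n=tk$ (case without offset) or $n=2(tk-m)$ (case with offset). In either case, the Modulo Krinkle tiling described in the context (a collection of congruent copies of the prototile) fills the plane correctly: the tiles cover $\mathbb{R}^2$ without gaps, and no two tiles overlap (their interiors are pairwise disjoint).
   Context: For an integer $i$ let $\vec v_i=(\cos\frac{2\pi i}{n},\sin\frac{2\pi i}{n})$. Given a point $\vec p$ and an integer sequence $(a_j)$, the curve defined by $\vec p$ and $(a_j)$ is the polygonal path through $\vec p_0=\vec p$, $\vec p_{j+1}=\vec p_j+\vec v_{a_j}$. Prototile: let $\ell_j=jm \bmod k$ for $0\le j\le k-1$ and $\ell_k=k$; let $(u_0,\dots,u_k)$ be $(\ell_0,\dots,\ell_k)$ with its first and last entries swapped, i.e. $(k,\ell_1,\dots,\ell_{k-1},0)$. The prototile with starting point $P$ is the simple polygon formed by the lower path (curve defined by $P$ and $(\ell_0,\dots,\ell_k)$) followed by the reverse of the upper path (curve defined by $P$ and $(u_0,\dots,u_k)$); both paths end at the same point. Its base edge is the first segment of the lower path. Wedge $0$: with $\vec d_0=\sum_{j=0}^{k-1}\vec v_{\ell_j}$ and $\vec d_1=\vec v_k-\vec v_0$, place, for all integers $0\le c\le r$, a translate $T_{r,c}$ of the prototile with starting point $r\vec d_0+c\vec d_1$. Wedge $0$ is bounded by its lower boundary, the curve from the origin with direction sequence $b_j=\ell^0_j:=jm\bmod k$ ($j\ge0$), and its upper boundary, the curve from the origin with direction sequence $u^0_j$, where $u^0_j=jm\bmod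 k$ if this is nonzero and $u^0_j=k$ otherwise. The base is the curve from the origin with direction sequence $(b_j)$. For $i\ge 0$ set $\ell^i_j=\ell^0_j+i$ and $u^i_j=u^0_j+i$. Placement: let $w=k$ (without offset) or $w=n/2=tk-m$ (with offset). The front after wedge $0$ is $f^0_j=u^0_j$. For $i=1,\dots,w-1$: let $j^*$ be the minimal index with $f^{i-1}_{j^*}=i$; wedge $i$ is wedge $0$ rotated counterclockwise by $\frac{2\pi i}{n}$ about the origin and then translated by $\sum_{j=0}^{j^*-1}\vec v_{f^{i-1}_j}$; the new front is $f^i_j=f^{i-1}_j$ for $j<j^*$ and $f^i_{j^*+j}=u^i_j$ for $j\ge0$ (the upper boundary of the region covered so far). Let $R$ be the union of wedges $0,\dots,w-1$. Final tiling: without offset, the tiling consists of $R$ together with its rotations about the origin by $\frac{2\pi q}{t}$, $q=1,\dots,t-1$. With offset, the tiling consists of $R$ together with the copy of $R$ rotated by $\pi$ about the midpoint of the first base edge (the segment from the origin to $\vec v_0$). *)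

theory Defs
  imports "HOL-Analysis.Analysis"
begin

definition vdir :: "nat \<Rightarrow> int \<Rightarrow> complex" where
  "vdir n i = cis (2 * pi * real_of_int i / real n)"

definition curve_pt :: "nat \<Rightarrow> complex \<Rightarrow> (nat \<Rightarrow> int) \<Rightarrow> nat \<Rightarrow> complex" where
  "curve_pt n p a j = p + (\<Sum>i<j. vdir n (a i))"

definition proto_low :: "nat \<Rightarrow> nat \<Rightarrow> nat \<Rightarrow> int" where
  "proto_low k m j = (if j < k then int ((j * m) mod k) else int k)"

(* prototile upper sequence u_0..u_k : l with first and last entries swapped *)
definition proto_up :: "nat \<Rightarrow> nat \<Rightarrow> nat \<Rightarrow> int" where
  "proto_up k m j = (if j = 0 then int k else if j = k then 0 else proto_low k m j)"

definition proto_boundary :: "nat \<Rightarrow> nat \<Rightarrow> nat \<Rightarrow> complex \<Rightarrow> complex set" where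
  "proto_boundary n k m P =
     (\<Union>j\<le>k. closed_segment (curve_pt n P (proto_low k m) j) (curve_pt n P (proto_low k m) (Suc j)))
   \<union> (\<Union>j\<le>k. closed_segment (curve_pt n P (proto_up k m) j) (curve_pt n P (proto_up k m) (Suc j)))"

definition prototile :: "nat \<Rightarrow> nat \<Rightarrow> nat \<Rightarrow> complex \<Rightarrow> complex set" where
  "prototile n k m P = proto_boundary n k m P \<union> inside (proto_boundary n k m P)"

definition wd0 :: "nat \<Rightarrow> nat \<Rightarrow> nat \<Rightarrow> complex" where
  "wd0 n k m = (\<Sum>j<k. vdir n (proto_low k m j))"

definition wd1 :: "nat \<Rightarrow> nat \<Rightarrow> complex" where
  "wd1 n k = vdir n (int k) - vdir n 0"

definition u0 :: "nat \<Rightarrow> nat \<Rightarrow> nat \<Rightarrow> int" where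
  "u0 k m j = (if (j * m) mod k \<noteq> 0 then int ((j * m) mod k) else int k)"

fun front :: "nat \<Rightarrow> nat \<Rightarrow> nat \<Rightarrow> nat \<Rightarrow> int" where
  "front k m 0 = u0 k m"
| "front k m (Suc i) =
     (let js = (LEAST j. front k m i j = int (Suc i))
      in (\<lambda>j. if j < js then front k m i j else u0 k m (j - js) + int (Suc i)))"

definition jstar :: "nat \<Rightarrow> nat \<Rightarrow> nat \<Rightarrow> nat" where
  "jstar k m i = (LEAST j. front k m (i - 1) j = int i)"

definition wedge_shift :: "nat \<Rightarrow> nat \<Rightarrow> nat \<Rightarrow> nat \<Rightarrow> complex" where
  "wedge_shift n k m i =
     (if i = 0 then 0 else (\<Sum>j<jstar k m i. vdir n (front k m (i - 1) j)))"

definition wedge_tile :: "nat \<Rightarrow> nat \<Rightarrow> nat \<Rightarrow> nat \<Rightarrow> nat \<Rightarrow> nat \<Rightarrow> complex set" where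
  "wedge_tile n k m i r c =
     (\<lambda>z. cis (2 * pi * real i / real n) * z + wedge_shift n k m i) `
       prototile n k m (of_nat r * wd0 n k m + of_nat c * wd1 n k)"

definition krinkle_tile_no_offset :: "nat \<Rightarrow> nat \<Rightarrow> nat \<Rightarrow> nat \<times> nat \<times> nat \<times> nat \<Rightarrow> complex set" where
  "krinkle_tile_no_offset k m t = (\<lambda>(q, i, r, c).
     (\<lambda>z. cis (2 * pi * real q / real t) * z) ` wedge_tile (t * k) k m i r c)"

definition krinkle_index_no_offset :: "nat \<Rightarrow> nat \<Rightarrow> (nat \<times> nat \<times> nat \<times> nat) set" where
  "krinkle_index_no_offset k t = {(q, i, r, c). q < t \<and> i < k \<and> c \<le> r}"

(* Tiling with offset: n = 2(tk - m), w = tk - m; q = 0: R itself,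
   q = 1: R rotated by pi about the midpoint 1/2 of the segment from 0 to v_0 = 1 *)
definition krinkle_tile_offset :: "nat \<Rightarrow> nat \<Rightarrow> nat \<Rightarrow> nat \<times> nat \<times> nat \<times> nat \<Rightarrow> complex set" where
  "krinkle_tile_offset k m t = (\<lambda>(q, i, r, c).
     (\<lambda>z. if q = 0 then z else 1 - z) ` wedge_tile (2 * (t * k - m)) k m i r c)"

definition krinkle_index_offset :: "nat \<Rightarrow> nat \<Rightarrow> nat \<Rightarrow> (nat \<times> nat \<times> nat \<times> nat) set" where
  "krinkle_index_offset k m t = {(q, i, r, c). q < 2 \<and> i < t * k - m \<and> c \<le> r}"

definition tiles_plane :: "('i \<Rightarrow> complex set) \<Rightarrow> 'i set \<Rightarrow> bool" where
  "tiles_plane T I \<longleftrightarrow>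
     (\<Union>x\<in>I. T x) = UNIV \<and>
     (\<forall>x\<in>I. \<forall>y\<in>I. x \<noteq> y \<longrightarrow> interior (T x) \<inter> interior (T y) = {})"

end

theory Submission
  imports Defs
begin

text \<open>
  The proof counts the tiles around a point \<open>z\<close> by winding numbers. If \<open>z\<close> lies on no tile
  boundary, the angles under which \<open>z\<close> sees the edges of a tile add up to \<open>2\<pi>\<close> if \<open>z\<close> lies in the
  tile and to \<open>0\<close> otherwise. Summed over the first \<open>R\<close> rows of a wedge, the contributions of
  interior edges cancel; the boundary curves of consecutive wedges cancel as well, because the
  front after \<open>i\<close> wedges has as its \<open>j\<close>-th direction the representative of \<open>jm\<close> modulo \<open>k\<close>
  in \<open>{i..<i+k}\<close>. There remains the outer zigzag of each wedge, whose angle tends to \<open>2\<pi>/n\<close>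
  as \<open>R\<close> grows. The total over all \<open>n\<close> wedges therefore tends to \<open>2\<pi>\<close>, so that exactly one tile
  contains \<open>z\<close>. Since the boundaries are negligible and the tiles are closed and locally finite,
  the tiles cover the plane and have disjoint interiors.
\<close>

section \<open>Angles subtended by segments\<close>

text \<open>The signed angle in (-pi, pi] under which \<open>z\<close> sees the segment from
  \<open>a\<close> to \<open>b\<close>. For \<open>z\<close> off the segment it is antisymmetric in
  the endpoints and continuous in \<open>z\<close>.\<close>

definition ang :: "complex \<Rightarrow> complex \<Rightarrow> complex \<Rightarrow> real" where
  "ang z a b = Arg ((b - z) / (a - z))"

text \<open>A difference of at least pi would put \<open>a\<close> below and \<open>b\<close> above
  the real axis with Im (b * cnj a) \<le> 0. The segment would then cross the real axis at a
  nonpositive point, that is, on the branch cut.\<close>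

lemma Arg_diff_less_pi:
  assumes "closed_segment a b \<inter> \<real>\<^sub>\<le>\<^sub>0 = {}"
  shows "Arg b - Arg a < pi"
proof (rule ccontr)
  assume "\<not> ?thesis"
  then have diff: "Arg b - Arg a \<ge> pi" by simp
  have a: "a \<notin> \<real>\<^sub>\<le>\<^sub>0" and b: "b \<notin> \<real>\<^sub>\<le>\<^sub>0" using assms by auto
  have "Arg b \<noteq> pi" using b Arg_eq_pi[of b] by (auto simp: complex_nonpos_Reals_iff)
  with Arg_le_pi[of b] have "Arg b < pi" by simp
  with diff mpi_less_Arg[of a] have pos: "Arg b > 0" and neg: "Arg a < 0" by auto
  have Ia: "Im a < 0" using neg Arg_neg_iff by blast
  have Ib: "Im b > 0" using pos \<open>Arg b < pi\<close> Arg_lt_pi by blast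
  have "sin (Arg b - Arg a) \<le> 0"
    using diff mpi_less_Arg[of a] \<open>Arg b < pi\<close> sin_ge_zero[of "Arg b - Arg a - pi"] by (simp add: sin_diff)
  moreover have "Im (b * cnj a) = norm a * norm b * sin (Arg b - Arg a)"
  proof -
    have "Re a = norm a * cos (Arg a)" "Im a = norm a * sin (Arg a)"
      "Re b = norm b * cos (Arg b)" "Im b = norm b * sin (Arg b)"
      using rcis_cmod_Arg[of a] rcis_cmod_Arg[of b] by (metis Re_rcis Im_rcis)+
    then show ?thesis by (simp add: sin_diff algebra_simps)
  qed
  ultimately have le: "Im b * Re a - Re b * Im a \<le> 0"
    by (simp add: mult_nonneg_nonpos algebra_simps)
  \<comment> \<open>The parameter at which the segment crosses the real axis.\<close>
  define s where "s = - Im a / (Im b - Im a)"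
  have s: "0 \<le> s" "s \<le> 1" using Ia Ib by (auto simp: s_def field_simps)
  let ?p = "(1 - s) *\<^sub>R a + s *\<^sub>R b"
  have "?p \<in> closed_segment a b" using s by (auto simp: in_segment)
  moreover have sd: "s * (Im b - Im a) = - Im a" using Ia Ib by (simp add: s_def)
  have "Im ?p = Im a + s * (Im b - Im a)" by (simp add: algebra_simps)
  then have "Im ?p = 0" unfolding sd by simp
  \<comment> \<open>After multiplication by Im b - Im a > 0 the real part of the crossing point
    becomes Im (b * cnj a).\<close>
  moreover have "Re ?p * (Im b - Im a) = Re a * (Im b - Im a) + (s * (Im b - Im a)) * (Re b - Re a)"
    by (simp add: algebra_simps)
  then have "Re ?p * (Im b - Im a) \<le> 0" unfolding sd using le by (simp add: algebra_simps)
  then have "Re ?p \<le> 0" using Ia Ib by (simp add: mult_le_0_iff)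
  ultimately show False using assms by (auto simp: complex_nonpos_Reals_iff)
qed

text \<open>The factor \<open>c\<close> turns the branch cut of \<open>Arg\<close> into a ray from
  \<open>z\<close> of any desired direction. Along a segment that misses this ray the argument
  changes by less than pi, so the argument of the quotient needs no correction by 2 * pi.\<close>

lemma ang_eq_Arg_diff:
  assumes "\<And>p. p \<in> closed_segment a b \<Longrightarrow> c * (p - z) \<notin> \<real>\<^sub>\<le>\<^sub>0"
  shows "ang z a b = Arg (c * (b - z)) - Arg (c * (a - z))"
proof -
  let ?a = "c * (a - z)" and ?b = "c * (b - z)"
  have "closed_segment ?a ?b = (\<lambda>p. c * (p - z)) ` closed_segment a b"
  proof -
    have "closed_segment ?a ?b = (*) c ` closed_segment (a - z) (b - z)"
      by (rule closed_segment_linear_image) (simp add: linear_times)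
    also have "closed_segment (a - z) (b - z) = (\<lambda>p. p - z) ` closed_segment a b"
      using closed_segment_translation[of "-z" a b] by simp
    finally show ?thesis by (simp add: image_image)
  qed
  then have "closed_segment ?a ?b \<inter> \<real>\<^sub>\<le>\<^sub>0 = {}" using assms by auto
  then have lt: "Arg ?b - Arg ?a < pi" "Arg ?a - Arg ?b < pi"
    using Arg_diff_less_pi[of ?a ?b] Arg_diff_less_pi[of ?b ?a] by (auto simp: closed_segment_commute)
  have nz: "?a \<noteq> 0" "?b \<noteq> 0" using assms[of a] assms[of b] by auto
  have "ang z a b = Arg (?b / ?a)" using nz by (simp add: ang_def)
  also have "\<dots> = Arg ?b - Arg ?a" unfolding Arg_divide'[OF nz(2,1)] using lt by auto
  finally show ?thesis .
qed

lemma sum_ang_eq_Arg_diff: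
  assumes "\<And>j p. j < N \<Longrightarrow> p \<in> closed_segment (X j) (X (Suc j)) \<Longrightarrow> c * (p - z) \<notin> \<real>\<^sub>\<le>\<^sub>0"
  shows "(\<Sum>j<N. ang z (X j) (X (Suc j))) = Arg (c * (X N - z)) - Arg (c * (X 0 - z))"
proof -
  have "(\<Sum>j<N. ang z (X j) (X (Suc j))) = (\<Sum>j<N. Arg (c * (X (Suc j) - z)) - Arg (c * (X j - z)))"
    using assms by (intro sum.cong ang_eq_Arg_diff) auto
  also have "\<dots> = Arg (c * (X N - z)) - Arg (c * (X 0 - z))"
    by (rule sum_lessThan_telescope)
  finally show ?thesis .
qed

lemma ang_affine:
  assumes "w \<noteq> 0"
  shows "ang (w * z + s) (w * a + s) (w * b + s) = ang z a b"
  using assms by (simp add: ang_def flip: right_diff_distrib)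

lemma ratio_nonpos_Reals_imp_in_segment:
  fixes a b z :: complex
  assumes "a \<noteq> z" "(b - z) / (a - z) \<in> \<real>\<^sub>\<le>\<^sub>0"
  shows "z \<in> closed_segment a b"
proof -
  obtain r where r: "(b - z) / (a - z) = of_real r" "r \<le> 0"
    using assms(2) by (auto elim: nonpos_Reals_cases)
  have "a - z \<noteq> 0" using assms(1) by simp
  then have b: "b - z = of_real r * (a - z)" using r(1) by (rule iffD1[OF nonzero_divide_eq_eq])
  then have b': "b = z + of_real r * (a - z)" by (simp add: algebra_simps)
  \<comment> \<open>The solution of (1 - s) + s * r = 0; it lies in the unit interval because r
    \<le> 0.\<close>
  define s where "s = 1 / (1 - r)"
  have s: "0 \<le> s" "s \<le> 1" "(1 - s) + s * r = 0" using r by (auto simp: s_def field_simps)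
  have "(1 - s) *\<^sub>R a + s *\<^sub>R b = z + of_real ((1 - s) + s * r) * (a - z)"
    unfolding b' by (simp add: scaleR_conv_of_real algebra_simps)
  then have "z = (1 - s) *\<^sub>R a + s *\<^sub>R b" using s by simp
  then show ?thesis using s unfolding in_segment by blast
qed

text \<open>Off the segment the quotient avoids the negative real axis, the only place where
  inversion fails to negate \<open>Arg\<close>.\<close>

lemma ang_commute:
  assumes "z \<notin> closed_segment a b"
  shows "ang z b a = - ang z a b"
proof -
  let ?q = "(b - z) / (a - z)"
  have q: "?q \<notin> \<real>\<^sub>\<le>\<^sub>0" using assms ratio_nonpos_Reals_imp_in_segment[of a z b] by auto
  have "Arg (inverse ?q) = - Arg ?q"
  proof (cases "?q \<in> \<real>")
    case True
    then have "Arg ?q = 0" using q by (auto simp: Arg_eq_0_iff complex_nonpos_Reals_iff complex_is_Real_iff)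
    then show ?thesis using True by (simp only: Arg_inverse) simp
  qed (simp only: Arg_inverse if_False)
  then show ?thesis by (simp add: ang_def)
qed

lemma continuous_on_ang [continuous_intros]:
  assumes "S \<inter> closed_segment a b = {}"
  shows "continuous_on S (\<lambda>z. ang z a b)"
proof -
  have "(b - z) / (a - z) \<notin> \<real>\<^sub>\<le>\<^sub>0" "a - z \<noteq> 0" if "z \<in> S" for z
    using assms that ratio_nonpos_Reals_imp_in_segment[of a z b] by auto
  then show ?thesis unfolding ang_def
    by (intro continuous_on_Arg' continuous_on_divide continuous_on_diff continuous_on_const continuous_on_id) auto
qed

section \<open>Polygons bounded by two monotone paths\<close>

text \<open>Models the prototile turned so that the bisector of its first two edges is the real
  axis. Only the first and the last edge of a path may be vertical, which happens for n = 2 * k;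
  \<open>2 \<le> N\<close> puts a non-vertical edge between them.\<close>

locale monotone_polygon =
  fixes N :: nat and L U :: "nat \<Rightarrow> complex"
  assumes N2: "2 \<le> N"
    and Re_U: "\<And>j. j \<le> Suc N \<Longrightarrow> Re (U j) = Re (L j)"
    and Im_le: "\<And>j. j \<le> Suc N \<Longrightarrow> Im (L j) \<le> Im (U j)"
    and Re_mono: "\<And>j. j \<le> N \<Longrightarrow> Re (L j) \<le> Re (L (Suc j))"
    and Re_strict: "\<And>j. 1 \<le> j \<Longrightarrow> j < N \<Longrightarrow> Re (L j) < Re (L (Suc j))"
begin

definition low where "low = (\<Union>j\<le>N. closed_segment (L j) (L (Suc j)))"
definition upp where "upp = (\<Union>j\<le>N. closed_segment (U j) (U (Suc j)))"

lemma Re_le: "i \<le> j \<Longrightarrow> j \<le> Suc N \<Longrightarrow> Re (L i) \<le> Re (L j)"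
proof (induction j rule: nat_induct)
  case (Suc j)
  then show ?case using Re_mono[of j] by (cases "i = Suc j") (auto simp: le_Suc_eq)
qed auto

lemma Re_less: "1 \<le> i \<Longrightarrow> i < j \<Longrightarrow> j \<le> N \<Longrightarrow> Re (L i) < Re (L j)"
  using Re_strict[of i] Re_le[of "Suc i" j] by simp

lemma Re_between:
  assumes "j \<le> N" "X = L \<or> X = U" "p \<in> closed_segment (X j) (X (Suc j))"
  shows "Re (L j) \<le> Re p" "Re p \<le> Re (L (Suc j))"
proof -
  obtain s where s: "0 \<le> s" "s \<le> 1" "p = (1 - s) *\<^sub>R X j + s *\<^sub>R X (Suc j)"
    using assms unfolding in_segment by blast
  have X: "Re (X j) = Re (L j)" "Re (X (Suc j)) = Re (L (Suc j))" using assms Re_U by auto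
  have p: "Re p = Re (L j) + s * (Re (L (Suc j)) - Re (L j))"
    unfolding s(3) by (simp add: X algebra_simps)
  have "0 \<le> s * (Re (L (Suc j)) - Re (L j))" "s * (Re (L (Suc j)) - Re (L j)) \<le> 1 * (Re (L (Suc j)) - Re (L j))"
    using s Re_mono[OF assms(1)] by (intro mult_nonneg_nonneg mult_right_mono; simp)+
  then show "Re (L j) \<le> Re p" "Re p \<le> Re (L (Suc j))" using p by auto
qed

lemma eq_endpoint:
  assumes "j \<le> N" "X = L \<or> X = U" "p \<in> closed_segment (X j) (X (Suc j))" "Re (L j) < Re (L (Suc j))"
  shows "Re p = Re (L j) \<Longrightarrow> p = X j" "Re p = Re (L (Suc j)) \<Longrightarrow> p = X (Suc j)"
proof -
  obtain s where s: "0 \<le> s" "s \<le> 1" "p = (1 - s) *\<^sub>R X j + s *\<^sub>R X (Suc j)"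
    using assms unfolding in_segment by blast
  have X: "Re (X j) = Re (L j)" "Re (X (Suc j)) = Re (L (Suc j))" using assms Re_U by auto
  have p: "Re p = Re (L j) + s * (Re (L (Suc j)) - Re (L j))"
    unfolding s(3) by (simp add: X algebra_simps)
  show "p = X j" if "Re p = Re (L j)" using that p s assms(4) by simp
  show "p = X (Suc j)" if "Re p = Re (L (Suc j))"
  proof -
    have "(s - 1) * (Re (L (Suc j)) - Re (L j)) = 0" using that p by (simp add: algebra_simps)
    then show ?thesis using s assms(4) by simp
  qed
qed

text \<open>Edges with different indices share an abscissa only if the indices are consecutive. Two
  consecutive edges are not both vertical, and on the non-vertical one the point must be the end
  vertex, which also lies on the neighbouring edge of its path.\<close>

lemma same_edge:
  assumes "p \<in> closed_segment (L i) (L (Suc i))" "i \<le> N"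
    and "X = L \<or> X = U" "q \<in> closed_segment (X j) (X (Suc j))" "j \<le> N" and eq: "Re p = Re q"
  shows "\<exists>l\<le>N. p \<in> closed_segment (L l) (L (Suc l)) \<and> q \<in> closed_segment (X l) (X (Suc l))"
proof -
  have L: "L = L \<or> L = U" by simp
  note P = Re_between[OF assms(2) L assms(1)] and Q = Re_between[OF assms(5,3,4)]
  note p = eq_endpoint[OF assms(2) L assms(1)] and q = eq_endpoint[OF assms(5,3,4)]
  consider "i = j" | "i < j" | "j < i" by linarith
  then show ?thesis
  proof cases
    case 1 then show ?thesis using assms by auto
  next
    case 2
    have e: "Re (L (Suc i)) = Re p" "Re (L j) = Re p" using P Q eq Re_le[of "Suc i" j] 2 assms by auto
    have j: "j = Suc i"
    proof (rule ccontr)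
      assume "j \<noteq> Suc i"
      then have "Re (L (Suc i)) < Re (L j)" using 2 assms(5) by (intro Re_less) auto
      then show False using e by simp
    qed
    show ?thesis
    proof (cases "Re (L i) < Re (L (Suc i))")
      case True
      then have "p = L j" using p(2) e(1) unfolding j by metis
      then show ?thesis using assms(1-5) j by (intro exI[of _ j]) simp
    next
      case False
      then have "i = 0" using Re_strict[of i] 2 assms(5) by (cases i) auto
      then have "Re (L j) < Re (L (Suc j))" using Re_strict[of 1] N2 j by simp
      then have "q = X j" using q(1) e(2) eq by metis
      then show ?thesis using assms(1-5) j by (intro exI[of _ i]) simp
    qed
  next
    case 3
    have e: "Re (L (Suc j)) = Re p" "Re (L i) = Re p" using P Q eq Re_le[of "Suc j" i] 3 assms by auto
    have i: "i = Suc j"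
    proof (rule ccontr)
      assume "i \<noteq> Suc j"
      then have "Re (L (Suc j)) < Re (L i)" using 3 assms(2) by (intro Re_less) auto
      then show False using e by simp
    qed
    show ?thesis
    proof (cases "Re (L j) < Re (L (Suc j))")
      case True
      then have "q = X i" using q(2) e(1) eq unfolding i by metis
      then show ?thesis using assms(1-5) i by (intro exI[of _ i]) simp
    next
      case False
      then have "j = 0" using Re_strict[of j] 3 assms(2) by (cases j) auto
      then have "Re (L i) < Re (L (Suc i))" using Re_strict[of 1] N2 i by simp
      then have "p = L i" using p(1) e(2) by metis
      then show ?thesis using assms(1-5) i by (intro exI[of _ j]) simp
    qed
  qed
qed

text \<open>On edges with a common index that are not vertical, equal abscissas mean equal
  parameters, so a point of the lower path cannot lie above \<open>q\<close>. Hence the edge is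
  vertical, and \<open>z\<close> lies on it.\<close>

lemma low_separation:
  assumes "p \<in> low" "q \<in> low \<union> upp" "Re p = Re z" "Re q = Re z" "Im q < Im z" "Im z < Im p"
  shows "z \<in> low"
proof -
  obtain i where i: "i \<le> N" "p \<in> closed_segment (L i) (L (Suc i))" using assms(1) by (auto simp: low_def)
  obtain X j where X: "X = L \<or> X = U" "j \<le> N" "q \<in> closed_segment (X j) (X (Suc j))"
    using assms(2) that unfolding low_def upp_def by auto
  obtain l where l: "l \<le> N" "p \<in> closed_segment (L l) (L (Suc l))" "q \<in> closed_segment (X l) (X (Suc l))"
    using same_edge[OF i(2,1) X(1,3,2)] assms(3,4) by auto
  obtain s where s: "0 \<le> s" "s \<le> 1" "p = (1 - s) *\<^sub>R L l + s *\<^sub>R L (Suc l)"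
    using l unfolding in_segment by blast
  obtain r where r: "0 \<le> r" "r \<le> 1" "q = (1 - r) *\<^sub>R X l + r *\<^sub>R X (Suc l)"
    using l unfolding in_segment by blast
  have XR: "Re (X l) = Re (L l)" "Re (X (Suc l)) = Re (L (Suc l))" using l X Re_U by auto
  have XI: "Im (L l) \<le> Im (X l)" "Im (L (Suc l)) \<le> Im (X (Suc l))" using l X Im_le by auto
  have qI: "Im q \<ge> (1 - r) * Im (L l) + r * Im (L (Suc l))"
    using r XI by (simp add: add_mono mult_left_mono)
  show ?thesis
  proof (cases "Re (L l) < Re (L (Suc l))")
    case True
    have "Re p = Re L0 + s * (Re (L (Suc l)) - Re (L l))" if "L0 = L l" for L0
      unfolding s(3) that by (simp add: algebra_simps)
    moreover have "Re q = Re L0 + r * (Re (L (Suc l)) - Re (L l))" if "L0 = L l" for L0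
      unfolding r(3) that by (simp add: XR algebra_simps)
    ultimately have "s = r" using True assms by auto
    then have "Im p \<le> Im q" using qI s by simp
    then show ?thesis using assms by simp
  next
    case False
    then have v: "Re (L (Suc l)) = Re (L l)" using Re_mono[OF l(1)] by simp
    have "Re p = Re (L l)" unfolding s(3) by (simp add: v algebra_simps)
    then have zR: "Re z = Re (L l)" using assms by simp
    define a where "a = Im (L l)"
    define b where "b = Im (L (Suc l))"
    have pI: "Im p = a + s * (b - a)" unfolding s(3) by (simp add: a_def b_def algebra_simps)
    have qI': "Im q \<ge> a + r * (b - a)" using qI by (simp add: a_def b_def algebra_simps)
    have bd: "min a b \<le> a + x * (b - a) \<and> a + x * (b - a) \<le> max a b" if "0 \<le> x" "x \<le> 1" for x :: real
    proof (cases "a \<le> b")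
      case True
      then have "0 \<le> x * (b - a)" "x * (b - a) \<le> 1 * (b - a)" using that by (intro mult_nonneg_nonneg mult_right_mono; simp)+
      then show ?thesis using True by simp
    next
      case False
      then have "0 \<le> x * (a - b)" "x * (a - b) \<le> 1 * (a - b)" using that by (intro mult_nonneg_nonneg mult_right_mono; simp)+
      then show ?thesis using False by (simp add: algebra_simps)
    qed
    have "min a b \<le> Im z" "Im z \<le> max a b" using bd[of s] bd[of r] s r pI qI' assms by auto
    then have "Im z \<in> closed_segment a b"
      by (auto simp: closed_segment_eq_real_ivl min_def max_def split: if_splits)
    then obtain y where y: "0 \<le> y" "y \<le> 1" "Im z = (1 - y) *\<^sub>R a + y *\<^sub>R b" by (auto simp: in_segment)
    have "z = (1 - y) *\<^sub>R L l + y *\<^sub>R L (Suc l)"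
      using y zR v by (auto simp: complex_eq_iff a_def b_def algebra_simps)
    then have "z \<in> closed_segment (L l) (L (Suc l))" using y unfolding in_segment by blast
    then show ?thesis using l by (auto simp: low_def)
  qed
qed

text \<open>Complex conjugation exchanges the two paths and reduces this to
  \<open>low_separation\<close>.\<close>

lemma upp_separation:
  assumes "p \<in> upp" "q \<in> low \<union> upp" "Re p = Re z" "Re q = Re z" "Im p < Im z" "Im z < Im q"
  shows "z \<in> upp"
proof -
  have seg: "closed_segment (cnj a) (cnj b) = cnj ` closed_segment a b" for a b
    by (rule closed_segment_linear_image) (rule bounded_linear.linear[OF bounded_linear_cnj])
  interpret c: monotone_polygon N "\<lambda>j. cnj (U j)" "\<lambda>j. cnj (L j)"
    using N2 Re_U Im_le Re_mono Re_strict by unfold_locales auto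
  have low: "c.low = cnj ` upp"
    by (subst c.low_def, subst upp_def, subst image_UN, subst seg) (rule refl)
  have upp: "c.upp = cnj ` low"
    by (subst c.upp_def, subst low_def, subst image_UN, subst seg) (rule refl)
  have "cnj z \<in> c.low"
  proof (rule c.low_separation[of "cnj p" "cnj q"])
    show "cnj p \<in> c.low" unfolding low by (rule imageI[OF assms(1)])
    show "cnj q \<in> c.low \<union> c.upp" unfolding low upp using assms(2) by blast
  qed (use assms in simp_all)
  then obtain w where "w \<in> upp" "cnj z = cnj w" unfolding low by blast
  then show ?thesis by simp
qed

text \<open>Each value of the angle sum comes with a witness for the position of \<open>z\<close>: a
  ray that escapes for 0, a chord through \<open>z\<close> for 2 * pi.
  \<open>inside_iff_angle\<close> consumes both.\<close>

lemma angle_sum_cases: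
  assumes z: "z \<notin> low \<union> upp" and ends: "U 0 = L 0" "U (Suc N) = L (Suc N)"
  defines "\<Theta> \<equiv> (\<Sum>j\<le>N. ang z (L j) (L (Suc j))) - (\<Sum>j\<le>N. ang z (U j) (U (Suc j)))"
  shows "(\<Theta> = 0 \<and> (\<exists>d. d \<noteq> 0 \<and> (\<forall>s\<ge>0. z + of_real s * d \<notin> low \<union> upp))) \<or>
         (\<Theta> = 2 * pi \<and> (\<exists>p\<in>low \<union> upp. \<exists>q\<in>low \<union> upp. z \<in> closed_segment p q))"
proof -
  have le_eq: "{..N} = {..<Suc N}" by auto
  \<comment> \<open>The factors \<i> and -\<i> make the branch cut point upwards and downwards from
    \<open>z\<close>.\<close>
  have up: "\<i> * (p - z) \<in> \<real>\<^sub>\<le>\<^sub>0 \<longleftrightarrow> Re p = Re z \<and> Im p \<ge> Im z"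
    and down: "- \<i> * (p - z) \<in> \<real>\<^sub>\<le>\<^sub>0 \<longleftrightarrow> Re p = Re z \<and> Im p \<le> Im z" for p
    by (auto simp: complex_nonpos_Reals_iff)
  have sumL: "(\<Sum>j\<le>N. ang z (L j) (L (Suc j))) = Arg (c * (L (Suc N) - z)) - Arg (c * (L 0 - z))"
    if "\<And>p. p \<in> low \<Longrightarrow> c * (p - z) \<notin> \<real>\<^sub>\<le>\<^sub>0" for c
    unfolding le_eq using that by (intro sum_ang_eq_Arg_diff) (auto simp: low_def less_Suc_eq_le)
  have sumU: "(\<Sum>j\<le>N. ang z (U j) (U (Suc j))) = Arg (c * (L (Suc N) - z)) - Arg (c * (L 0 - z))"
    if "\<And>p. p \<in> upp \<Longrightarrow> c * (p - z) \<notin> \<real>\<^sub>\<le>\<^sub>0" for c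
    unfolding le_eq ends[symmetric] using that
    by (intro sum_ang_eq_Arg_diff) (auto simp: upp_def less_Suc_eq_le)
  show ?thesis
  proof (cases "(\<exists>p\<in>low \<union> upp. Re p = Re z \<and> Im p \<ge> Im z) \<and> (\<exists>q\<in>low \<union> upp. Re q = Re z \<and> Im q \<le> Im z)")
    \<comment> \<open>One vertical ray from \<open>z\<close> misses both paths, so one branch of the
      argument serves both. As they share their endpoints, the two sums agree.\<close>
    case False
    then consider "\<forall>p\<in>low \<union> upp. \<not> (Re p = Re z \<and> Im p \<ge> Im z)"
      | "\<forall>p\<in>low \<union> upp. \<not> (Re p = Re z \<and> Im p \<le> Im z)" by blast
    then show ?thesis
    proof cases
      case 1
      have "p \<in> low \<union> upp \<Longrightarrow> \<i> * (p - z) \<notin> \<real>\<^sub>\<le>\<^sub>0" for p using 1 up by blast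
      then have "\<Theta> = 0" unfolding \<Theta>_def by (subst sumL[of \<i>], blast, subst sumU[of \<i>], blast) simp
      moreover have "\<forall>s\<ge>0. z + of_real s * \<i> \<notin> low \<union> upp" 
      proof (intro allI impI notI)
        fix s :: real assume "s \<ge> 0" "z + of_real s * \<i> \<in> low \<union> upp"
        with 1[rule_format, of "z + of_real s * \<i>"] show False by simp
      qed
      ultimately show ?thesis using complex_i_not_zero by blast
    next
      case 2
      have "p \<in> low \<union> upp \<Longrightarrow> -\<i> * (p - z) \<notin> \<real>\<^sub>\<le>\<^sub>0" for p using 2 down by blast
      then have "\<Theta> = 0" unfolding \<Theta>_def by (subst sumL[of "-\<i>"], blast, subst sumU[of "-\<i>"], blast) simp
      moreover have "\<forall>s\<ge>0. z + of_real s * (-\<i>) \<notin> low \<union> upp" 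
      proof (intro allI impI notI)
        fix s :: real assume "s \<ge> 0" "z + of_real s * (-\<i>) \<in> low \<union> upp"
        with 2[rule_format, of "z + of_real s * (-\<i>)"] show False by simp
      qed
      moreover have "-\<i> \<noteq> 0" by simp
      ultimately show ?thesis by blast
    qed
  next
    \<comment> \<open>Both vertical rays hit the boundary. By the separation lemmas the lower path
      meets the vertical line only below \<open>z\<close> and the upper path only above, so each
      path gets its own branch.\<close>
    case True
    then obtain p q where p: "p \<in> low \<union> upp" "Re p = Re z" "Im p \<ge> Im z"
      and q: "q \<in> low \<union> upp" "Re q = Re z" "Im q \<le> Im z" by blast
    have ne: "x \<noteq> z" if "x \<in> low \<union> upp" for x using z that by auto
    have p': "Im p > Im z" using p ne[of p] by (auto simp: complex_eq_iff less_le)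
    have q': "Im q < Im z" using q ne[of q] by (auto simp: complex_eq_iff less_le)
    have lowup: "\<not> (Re x = Re z \<and> Im x \<ge> Im z)" if "x \<in> low" for x
    proof
      assume x: "Re x = Re z \<and> Im x \<ge> Im z"
      then have "Im x > Im z" using ne[of x] that by (auto simp: complex_eq_iff less_le)
      then have "z \<in> low" using low_separation[OF that q(1) _ q(2) q'] x by auto
      then show False using z by simp
    qed
    have uppdown: "\<not> (Re x = Re z \<and> Im x \<le> Im z)" if "x \<in> upp" for x
    proof
      assume x: "Re x = Re z \<and> Im x \<le> Im z"
      then have "Im x < Im z" using ne[of x] that by (auto simp: complex_eq_iff less_le)
      then have "z \<in> upp" using upp_separation[OF that p(1) _ p(2) _ p'] x by auto
      then show False using z by simp
    qed
    have "U 0 \<in> upp" "U (Suc N) \<in> upp" by (auto simp: upp_def intro: UN_I[of 0] UN_I[of N])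
    moreover have "L 0 \<in> low" "L (Suc N) \<in> low" by (auto simp: low_def intro: UN_I[of 0] UN_I[of N])
    ultimately have L0: "L 0 \<in> low" "L 0 \<in> upp" "L (Suc N) \<in> low" "L (Suc N) \<in> upp"
      by (simp_all add: ends)
    have "q \<in> low" using uppdown q by blast
    then obtain j where j: "j \<le> N" "q \<in> closed_segment (L j) (L (Suc j))" by (auto simp: low_def)
    then have "Re (L j) \<le> Re q" "Re q \<le> Re (L (Suc j))" using Re_between[of j L q] by auto
    then have "Re (L 0) \<le> Re z" "Re z \<le> Re (L (Suc N))"
      using Re_le[of 0 j] Re_le[of "Suc j" "Suc N"] j q by auto
    \<comment> \<open>The endpoints belong to both paths, hence can be neither above nor below
      \<open>z\<close> on its vertical line.\<close>
    moreover have "Re (L 0) \<noteq> Re z" "Re (L (Suc N)) \<noteq> Re z"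
      using lowup uppdown L0 by (meson linear)+
    ultimately have R: "Re (L 0 - z) < 0" "Re (L (Suc N) - z) > 0" by auto
    \<comment> \<open>The two branches differ by pi to the right of \<open>z\<close> and by -pi to
      the left, so each of the two ends contributes pi.\<close>
    have A: "Arg (\<i> * w) - Arg (- \<i> * w) = pi" if "Re w > 0" for w
    proof -
      have "Arg (\<i> * w) > 0" using that by (simp add: Arg_pos_iff)
      moreover have "w \<noteq> 0" using that by auto
      ultimately show ?thesis using Arg_minus[of "\<i> * w"] by simp
    qed
    have A': "Arg (\<i> * w) - Arg (- \<i> * w) = - pi" if "Re w < 0" for w
    proof -
      have "Arg (\<i> * w) < 0" using that by (simp add: Arg_neg_iff)
      moreover have "w \<noteq> 0" using that by auto
      ultimately show ?thesis using Arg_minus[of "\<i> * w"] by simp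
    qed
    have "\<Theta> = (Arg (\<i> * (L (Suc N) - z)) - Arg (\<i> * (L 0 - z))) -
        (Arg (-\<i> * (L (Suc N) - z)) - Arg (-\<i> * (L 0 - z)))"
      unfolding \<Theta>_def using lowup uppdown
      by (subst sumL[of \<i>], use up in blast, subst sumU[of "-\<i>"], use down in blast) (rule refl)
    also have "\<dots> = 2 * pi" using A[OF R(2)] A'[OF R(1)] by simp
    finally have "\<Theta> = 2 * pi" .
    moreover have "z \<in> closed_segment q p"
    proof -
      define s where "s = (Im z - Im q) / (Im p - Im q)"
      have s: "0 \<le> s" "s \<le> 1" "s * (Im p - Im q) = Im z - Im q" using p' q' by (auto simp: s_def field_simps)
      have "Im ((1 - s) *\<^sub>R q + s *\<^sub>R p) = Im q + s * (Im p - Im q)" by (simp add: algebra_simps)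
      moreover have "Re ((1 - s) *\<^sub>R q + s *\<^sub>R p) = Re z" using p q by (simp add: algebra_simps)
      ultimately have "z = (1 - s) *\<^sub>R q + s *\<^sub>R p" unfolding complex_eq_iff s(3) by simp
      then show ?thesis using s unfolding in_segment by blast
    qed
    ultimately show ?thesis using p q by blast
  qed
qed

end

section \<open>The prototile\<close>

text \<open>An escaping ray makes the component of \<open>z\<close> unbounded. If \<Theta> is
  \<open>c\<close> at \<open>z\<close>, then, being continuous with two possible values, it is
  \<open>c\<close> on the whole component; every point there lies on a chord of \<open>B\<close>, so
  the component stays in the bounded convex hull of \<open>B\<close>.\<close>

lemma inside_iff_angle:
  fixes B :: "complex set" and \<Theta> :: "complex \<Rightarrow> real"
  assumes "bounded B" "c \<noteq> 0" "continuous_on (- B) \<Theta>"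
    and cases: "\<And>z. z \<notin> B \<Longrightarrow> (\<Theta> z = 0 \<and> (\<exists>d. d \<noteq> 0 \<and> (\<forall>s\<ge>0. z + of_real s * d \<notin> B))) \<or>
         (\<Theta> z = c \<and> (\<exists>p\<in>B. \<exists>q\<in>B. z \<in> closed_segment p q))"
    and z: "z \<notin> B"
  shows "\<Theta> z = (if z \<in> inside B then c else 0)"
proof -
  let ?C = "connected_component_set (- B) z"
  have "z \<notin> inside B" if d: "d \<noteq> 0" and ray: "\<forall>s\<ge>0. z + of_real s * d \<notin> B" for d
  proof
    assume "z \<in> inside B"
    then have "bounded ?C" by (simp add: inside_def)
    let ?R = "(\<lambda>s. z + of_real s * d) ` {0..}"
    have "?R \<subseteq> ?C"
    proof (rule connected_component_maximal)
      show "z \<in> ?R" by (rule image_eqI[of _ _ 0]) auto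
      show "connected ?R" by (intro connected_continuous_image continuous_intros) auto
      show "?R \<subseteq> - B" using ray by auto
    qed
    with \<open>bounded ?C\<close> have "bounded ?R" by (rule bounded_subset)
    then obtain K where K: "\<And>w. w \<in> ?R \<Longrightarrow> norm w \<le> K" by (auto simp: bounded_iff)
    \<comment> \<open>Chosen so that the ray point at parameter \<open>s\<close> has norm larger
      than \<open>K\<close>.\<close>
    define s where "s = (norm z + \<bar>K\<bar> + 1) / norm d"
    have s0: "s \<ge> 0" using d by (simp add: s_def)
    then have "norm (of_real s * d) = s * norm d" by (simp add: norm_mult)
    also have "\<dots> = norm z + \<bar>K\<bar> + 1" using d by (simp add: s_def)
    finally have s: "s \<ge> 0" "norm (of_real s * d) = norm z + \<bar>K\<bar> + 1" using s0 by auto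
    have "norm (z + of_real s * d) \<le> K" using s by (intro K) auto
    moreover have "norm (of_real s * d) \<le> norm (z + of_real s * d) + norm z"
      using norm_triangle_ineq4[of "z + of_real s * d" z] by simp
    ultimately show False using s by linarith
  qed
  moreover have "z \<in> inside B" if "\<Theta> z = c"
  proof -
    have CB: "?C \<subseteq> - B" by (rule connected_component_subset)
    have zC: "z \<in> ?C" using z by simp
    have "\<Theta> ` ?C \<subseteq> {0, c}" using cases CB by blast
    then have fin: "finite (\<Theta> ` ?C)" by (rule finite_subset) simp
    have "\<Theta> constant_on ?C"
      by (rule continuous_finite_range_constant[OF connected_connected_component])
        (use continuous_on_subset[OF assms(3) CB] fin in auto)
    then have const: "\<Theta> w = c" if "w \<in> ?C" for w
      using that zC \<open>\<Theta> z = c\<close> unfolding constant_on_def by metis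
    have "?C \<subseteq> convex hull B"
    proof
      fix w assume w: "w \<in> ?C"
      then obtain p q where "p \<in> B" "q \<in> B" "w \<in> closed_segment p q"
        using cases[of w] CB const[of w] \<open>c \<noteq> 0\<close> by auto
      then show "w \<in> convex hull B"
        using closed_segment_subset[OF hull_inc hull_inc convex_convex_hull] by blast
    qed
    then have "bounded ?C" using bounded_convex_hull[OF assms(1)] bounded_subset by blast
    then show ?thesis using z by (simp add: inside_def)
  qed
  ultimately show ?thesis using cases[OF z] by auto
qed

text \<open>The upper path is run backwards, hence the minus sign.\<close>

definition proto_angle :: "nat \<Rightarrow> nat \<Rightarrow> nat \<Rightarrow> complex \<Rightarrow> complex \<Rightarrow> real" where
  "proto_angle n k m P z =
     (\<Sum>j\<le>k. ang z (curve_pt n P (proto_low k m) j) (curve_pt n P (proto_low k m) (Suc j))) -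
     (\<Sum>j\<le>k. ang z (curve_pt n P (proto_up k m) j) (curve_pt n P (proto_up k m) (Suc j)))"

lemma curve_pt_0 [simp]: "curve_pt n P a 0 = P"
  by (simp add: curve_pt_def)

lemma curve_pt_Suc: "curve_pt n P a (Suc j) = curve_pt n P a j + vdir n (a j)"
  by (simp add: curve_pt_def)

section \<open>Topology and measure of the prototile\<close>

lemma compact_proto_boundary: "compact (proto_boundary n k m P)"
  unfolding proto_boundary_def by (intro compact_Un compact_UN) auto

lemma closed_prototile: "closed (prototile n k m P)"
  unfolding prototile_def union_with_inside
  using compact_imp_closed[OF compact_proto_boundary] by (intro closed_Compl open_outside)

lemma negligible_proto_boundary: "negligible (proto_boundary n k m P)"
proof -
  have "negligible (closed_segment a b)" for a b :: complex
    by (simp add: negligible_convex_interior interior_closed_segment_ge2)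
  then show ?thesis unfolding proto_boundary_def
    by (intro negligible_Un negligible_Union) auto
qed

text \<open>The bound \<open>2 * k \<le> n\<close> holds for both tilings; it says that the
  directions 0 to k span at most half a turn.\<close>

locale krinkle =
  fixes n k m :: nat
  assumes m_pos: "0 < m" and m_less: "m < k" and coprime_mk: "coprime m k" and n_ge: "2 * k \<le> n"
begin

abbreviation "v \<equiv> vdir n"
abbreviation "d0 \<equiv> wd0 n k m"
abbreviation "d1 \<equiv> wd1 n k"

text \<open>The direction of the angle bisector of the first two edges of the prototile, which is
  orthogonal to \<open>d1\<close>.\<close>
definition e :: complex where "e = cis (pi * real k / real n)"

lemma k_ge2: "2 \<le> k" and n_pos: "0 < n"
  using m_pos m_less n_ge by auto

lemma norm_e [simp]: "norm e = 1" and e_nz [simp]: "e \<noteq> 0"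
  by (auto simp: e_def)

section \<open>Directions measured from the bisector\<close>

lemma cnj_e_v: "cnj e * v a = cis (pi * (2 * of_int a - real k) / real n)"
proof -
  have "cnj e * v a = cis (- (pi * real k / real n) + 2 * pi * of_int a / real n)"
    by (simp add: e_def vdir_def cis_cnj cis_mult)
  also have "- (pi * real k / real n) + 2 * pi * of_int a / real n = pi * (2 * of_int a - real k) / real n"
    using n_pos by (simp add: field_simps)
  finally show ?thesis .
qed

text \<open>The angle between the direction and \<open>e\<close> is at most pi * k / n \<le> pi /
  2.\<close>

lemma Re_cnj_e_v_nonneg:
  assumes "0 \<le> a" "a \<le> int k"
  shows "0 \<le> Re (cnj e * v a)"
proof -
  have "\<bar>2 * real_of_int a - real k\<bar> \<le> real n / 2" using assms n_ge by linarith
  then have "pi * \<bar>2 * real_of_int a - real k\<bar> \<le> pi * (real n / 2)" by (intro mult_left_mono) auto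
  moreover have "\<bar>pi * (2 * of_int a - real k) / real n\<bar> = pi * \<bar>2 * real_of_int a - real k\<bar> / real n"
    by (simp add: abs_mult)
  ultimately have "\<bar>pi * (2 * of_int a - real k) / real n\<bar> \<le> pi / 2"
    using n_pos by (simp add: pos_divide_le_eq)
  then show ?thesis unfolding cnj_e_v cis.sel abs_le_iff by (intro cos_ge_zero) linarith+
qed

lemma Re_cnj_e_v_pos:
  assumes "0 < a" "a < int k"
  shows "0 < Re (cnj e * v a)"
proof -
  have "\<bar>2 * real_of_int a - real k\<bar> < real n / 2" using assms n_ge by linarith
  then have "pi * \<bar>2 * real_of_int a - real k\<bar> < pi * (real n / 2)" by (intro mult_strict_left_mono) auto
  moreover have "\<bar>pi * (2 * of_int a - real k) / real n\<bar> = pi * \<bar>2 * real_of_int a - real k\<bar> / real n"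
    by (simp add: abs_mult)
  ultimately have "\<bar>pi * (2 * of_int a - real k) / real n\<bar> < pi / 2"
    using n_pos by (simp add: pos_divide_less_eq)
  then show ?thesis unfolding cnj_e_v cis.sel abs_less_iff by (intro cos_gt_zero_pi) linarith+
qed

lemma cnj_e_d1: "cnj e * d1 = of_real (2 * sin (pi * real k / real n)) * \<i>"
proof -
  have "cnj e * d1 = cnj e * v (int k) - cnj e * v 0" by (simp add: wd1_def algebra_simps)
  then show ?thesis by (simp add: cnj_e_v complex_eq_iff)
qed

lemma Re_cnj_e_d1: "Re (cnj e * d1) = 0"
  unfolding cnj_e_d1 by simp

lemma Im_cnj_e_d1: "Im (cnj e * d1) \<ge> 0"
proof -
  have "pi * real k \<le> pi * real n" using n_ge by (intro mult_left_mono) auto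
  then have "sin (pi * real k / real n) \<ge> 0" using n_pos by (intro sin_ge_zero) (auto simp: field_simps)
  then show ?thesis unfolding cnj_e_d1 by simp
qed

lemma mult_mod_k_eq_0: "(j * m) mod k = 0 \<longleftrightarrow> k dvd j"
  using coprime_mk by (metis coprime_commute coprime_dvd_mult_left_iff mod_eq_0_iff_dvd)

lemma proto_low_bounds: "0 \<le> proto_low k m j" "proto_low k m j \<le> int k"
  using m_less by (auto simp: proto_low_def intro: less_imp_le)

lemma proto_low_strict: "1 \<le> j \<Longrightarrow> j < k \<Longrightarrow> 0 < proto_low k m j \<and> proto_low k m j < int k"
  using mult_mod_k_eq_0[of j] m_less by (auto simp: proto_low_def dest: dvd_imp_le)

text \<open>The first edges differ by \<open>d1\<close>, and the entries 1 to k - 1 of the two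
  sequences agree.\<close>

lemma curve_up_eq_low:
  assumes "1 \<le> j" "j \<le> k"
  shows "curve_pt n P (proto_up k m) j = curve_pt n P (proto_low k m) j + d1"
  using assms
proof (induction j rule: dec_induct)
  case base
  then show ?case using m_less by (simp add: curve_pt_Suc proto_up_def proto_low_def wd1_def)
next
  case (step j)
  then show ?case by (simp add: curve_pt_Suc proto_up_def)
qed

lemma curve_up_end:
  "curve_pt n P (proto_up k m) (Suc k) = curve_pt n P (proto_low k m) (Suc k)"
  using curve_up_eq_low[of k P] k_ge2 by (simp add: curve_pt_Suc proto_up_def proto_low_def wd1_def)

text \<open>Multiplication by \<open>cnj e\<close> makes the prototile a
  \<open>monotone_polygon\<close>: between the common ends the upper path is the lower one moved up
  by the image of \<open>d1\<close>. Then \<open>inside_iff_angle\<close> applies.\<close>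

lemma proto_angle_eq:
  assumes "z \<notin> proto_boundary n k m P"
  shows "proto_angle n k m P z = (if z \<in> prototile n k m P then 2 * pi else 0)"
proof -
  let ?B = "proto_boundary n k m P"
  let ?Lo = "curve_pt n P (proto_low k m)" and ?Up = "curve_pt n P (proto_up k m)"
  define f where "f = (*) (cnj e)"
  define L where "L = (\<lambda>j. f (?Lo j))"
  define U where "U = (\<lambda>j. f (?Up j))"
  have f_add: "f (a + b) = f a + f b" for a b by (simp add: f_def algebra_simps)
  have e1: "e * cnj e = 1" by (metis complex_norm_square norm_e of_real_1 one_power2)
  have f_inv: "e * f z = z" for z unfolding f_def by (simp add: e1 flip: mult.assoc)
  have f_ends: "U 0 = L 0" "U (Suc k) = L (Suc k)" by (simp_all add: L_def U_def curve_up_end)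
  have f_mid: "U j = L j + f d1" if "1 \<le> j" "j \<le> k" for j
    using curve_up_eq_low[OF that] by (simp add: L_def U_def f_add)
  have UL: "U j = L j \<or> U j = L j + f d1" if "j \<le> Suc k" for j
    using f_ends f_mid[of j] that by (cases "j = 0"; cases "j = Suc k") auto
  interpret p: monotone_polygon k L U
  proof
    show "2 \<le> k" by (rule k_ge2)
    show "Re (U j) = Re (L j)" "Im (L j) \<le> Im (U j)" if "j \<le> Suc k" for j
      using UL[OF that] Re_cnj_e_d1 Im_cnj_e_d1 by (auto simp: f_def)
    have step: "Re (L (Suc j)) = Re (L j) + Re (cnj e * v (proto_low k m j))" for j
      by (simp only: L_def curve_pt_Suc f_add plus_complex.sel) (simp only: f_def)
    show "Re (L j) \<le> Re (L (Suc j))" for j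
      using Re_cnj_e_v_nonneg[OF proto_low_bounds, of j] step[of j] by linarith
    show "Re (L j) < Re (L (Suc j))" if "1 \<le> j" "j < k" for j
      using Re_cnj_e_v_pos[of "proto_low k m j"] proto_low_strict[OF that] step[of j] by linarith
  qed
  have seg: "closed_segment (f a) (f b) = f ` closed_segment a b" for a b
    unfolding f_def by (rule closed_segment_linear_image) (simp add: linear_times)
  have B: "p.low \<union> p.upp = f ` ?B"
    unfolding p.low_def p.upp_def proto_boundary_def image_Un image_UN by (simp only: L_def U_def seg)
  have inj: "inj f" by (rule injI) (metis f_inv)
  have ang: "ang (f z) (f a) (f b) = ang z a b" for z a b
    using ang_affine[of "cnj e" z 0 a b] by (simp add: f_def)
  have cases: "(proto_angle n k m P z = 0 \<and> (\<exists>d. d \<noteq> 0 \<and> (\<forall>s\<ge>0. z + of_real s * d \<notin> ?B))) \<or>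
         (proto_angle n k m P z = 2 * pi \<and> (\<exists>p\<in>?B. \<exists>q\<in>?B. z \<in> closed_segment p q))"
    if z: "z \<notin> ?B" for z
  proof -
    have fz: "f z \<notin> p.low \<union> p.upp" unfolding B using z inj by (auto dest: injD)
    have \<Theta>: "(\<Sum>j\<le>k. ang (f z) (L j) (L (Suc j))) - (\<Sum>j\<le>k. ang (f z) (U j) (U (Suc j))) = proto_angle n k m P z"
      by (simp add: L_def U_def ang proto_angle_def)
    from p.angle_sum_cases[OF fz f_ends, unfolded \<Theta> B]
    show ?thesis
    proof (elim disjE conjE exE)
      fix d :: complex
      assume 0: "proto_angle n k m P z = 0" and d: "d \<noteq> 0" "\<forall>s\<ge>0. f z + of_real s * d \<notin> f ` ?B"
      \<comment> \<open>The escaping ray is turned back by \<open>e\<close>.\<close>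
      have "z + of_real s * (e * d) \<notin> ?B" if "s \<ge> 0" for s
      proof
        assume "z + of_real s * (e * d) \<in> ?B"
        then have "f (z + of_real s * (e * d)) \<in> f ` ?B" by blast
        moreover have "f (z + of_real s * (e * d)) = f z + of_real s * (e * cnj e) * d"
          by (simp add: f_def algebra_simps)
        ultimately show False using d that unfolding e1 by simp
      qed
      moreover have "e * d \<noteq> 0" using d by simp
      ultimately show ?thesis using 0 by blast
    next
      assume 1: "proto_angle n k m P z = 2 * pi" and "\<exists>p\<in>f ` ?B. \<exists>q\<in>f ` ?B. f z \<in> closed_segment p q"
      then obtain p q where pq: "p \<in> ?B" "q \<in> ?B" "f z \<in> f ` closed_segment p q" by (auto simp: seg)
      then have "z \<in> closed_segment p q" using inj by (auto dest: injD)
      then show ?thesis using 1 pq by blast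
    qed
  qed
  have "continuous_on (- ?B) (proto_angle n k m P)"
    unfolding proto_angle_def[abs_def]
    by (intro continuous_on_diff continuous_on_sum continuous_on_ang) (auto simp: proto_boundary_def)
  then have "proto_angle n k m P z = (if z \<in> inside ?B then 2 * pi else 0)"
    using compact_imp_bounded[OF compact_proto_boundary] cases assms
    by (intro inside_iff_angle) auto
  then show ?thesis using assms by (simp add: prototile_def)
qed

end

section \<open>Fronts\<close>

lemma vdir_add: "vdir n (a + b) = vdir n a * vdir n b"
  by (simp add: vdir_def cis_mult algebra_simps add_divide_distrib)

lemma vdir_0 [simp]: "vdir n 0 = 1"
  by (simp add: vdir_def)

lemma norm_vdir [simp]: "norm (vdir n a) = 1" and vdir_nz [simp]: "vdir n a \<noteq> 0"
  by (auto simp: vdir_def)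

lemma sum_lessThan_add:
  fixes f :: "nat \<Rightarrow> 'a::comm_monoid_add"
  shows "(\<Sum>j<a + b. f j) = (\<Sum>j<a. f j) + (\<Sum>j<b. f (a + j))"
  by (induction b) (simp_all add: add.assoc)

context krinkle
begin

text \<open>The front of the paper after wedge \<open>i - 1\<close>: the representative of \<open>l * m\<close> modulo \<open>k\<close>
  in the window \<open>{i..<i + k}\<close>.\<close>
definition gdir :: "nat \<Rightarrow> nat \<Rightarrow> int" where
  "gdir i l = int i + (int l * int m - int i) mod int k"

text \<open>The index at which wedge \<open>i\<close> is attached. It is taken on
  \<open>gdir i\<close>, so that wedge 0 needs no separate treatment.\<close>

definition js :: "nat \<Rightarrow> nat" where
  "js i = (LEAST j. gdir i j = int i)"

text \<open>Vertices of the base for \<open>i = 0\<close> and of the front after wedge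
  \<open>i - 1\<close> otherwise.\<close>

definition F :: "nat \<Rightarrow> nat \<Rightarrow> complex" where
  "F i j = (\<Sum>l<j. v (gdir i l))"

lemma bij_betw_mult_mod: "bij_betw (\<lambda>j. (j * m) mod k) {..<k} {..<k}"
proof -
  have "inj_on (\<lambda>j. (j * m) mod k) {..<k}"
  proof (rule linorder_inj_onI)
    fix x y assume "x < y" "x \<in> {..<k}" "y \<in> {..<k}"
    show "(x * m) mod k \<noteq> (y * m) mod k"
    proof
      assume "(x * m) mod k = (y * m) mod k"
      then have "k dvd y * m - x * m"
        by (metis mod_eq_dvd_iff_nat \<open>x < y\<close> less_imp_le mult_le_mono1)
      then have "k dvd (y - x) * m" by (simp add: diff_mult_distrib)
      then have "k dvd y - x" using mult_mod_k_eq_0[of "y - x"] by (simp add: mod_eq_0_iff_dvd)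
      then have "k \<le> y - x" using \<open>x < y\<close> by (intro dvd_imp_le) auto
      then show False using \<open>y \<in> {..<k}\<close> \<open>x < y\<close> by simp
    qed
  qed auto
  moreover have "(\<lambda>j. (j * m) mod k) ` {..<k} \<subseteq> {..<k}" using m_less by auto
  ultimately show ?thesis by (simp add: bij_betw_def endo_inj_surj)
qed

lemma gdir_0: "gdir 0 l = int ((l * m) mod k)"
  by (simp add: gdir_def zmod_int)

text \<open>As \<open>m\<close> is invertible modulo \<open>k\<close>, every residue occurs and the
  least index exists.\<close>

lemma gdir_js: "gdir i (js i) = int i"
  unfolding js_def
proof (rule LeastI_ex)
  have "i mod k \<in> (\<lambda>j. (j * m) mod k) ` {..<k}"
    using bij_betw_imp_surj_on[OF bij_betw_mult_mod] m_less by simp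
  then obtain j where "(j * m) mod k = i mod k" by force
  then have "int (j * m) mod int k = int i mod int k" by (metis zmod_int)
  then have "(int j * int m - int i) mod int k = 0" by (simp add: mod_eq_dvd_iff)
  then have "gdir i j = int i" by (simp add: gdir_def)
  then show "\<exists>j. gdir i j = int i" by blast
qed

text \<open>Moving the window of representatives up by one replaces only its least element.\<close>

lemma gdir_Suc: "gdir (Suc i) l = (if gdir i l = int i then int i + int k else gdir i l)"
proof -
  let ?x = "int l * int m - int i"
  have k: "int k > 0" using m_less by simp
  have "(?x - 1) mod int k = (?x mod int k - 1) mod int k" by (simp add: mod_simps)
  also have "\<dots> = (if ?x mod int k = 0 then int k - 1 else ?x mod int k - 1)"
  proof (cases "?x mod int k = 0")
    case True
    then show ?thesis using k by (simp add: zmod_minus1)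
  next
    case False
    moreover have "0 \<le> ?x mod int k" "?x mod int k < int k" using k by auto
    ultimately show ?thesis by (simp add: mod_pos_pos_trivial)
  qed
  finally have "(int l * int m - int (Suc i)) mod int k =
      (if ?x mod int k = 0 then int k - 1 else ?x mod int k - 1)" by (simp add: algebra_simps)
  then show ?thesis by (auto simp: gdir_def)
qed

lemma gdir_less_js: "l < js i \<Longrightarrow> gdir (Suc i) l = gdir i l"
  using not_less_Least[of l "\<lambda>j. gdir i j = int i"] by (auto simp: gdir_Suc js_def)

lemma gdir_1: "gdir (Suc 0) l = u0 k m l"
  by (auto simp: gdir_Suc gdir_0 u0_def)

text \<open>Since js i * m is congruent to i modulo k, the front continues from \<open>js i\<close>
  on as the lower boundary of the rotated wedge: wedge \<open>i\<close> fits onto what is already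
  there.\<close>

lemma gdir_js_add: "gdir i (js i + j) = int i + gdir 0 j"
proof -
  have "(int (js i) * int m - int i) mod int k = 0" using gdir_js[of i] by (simp add: gdir_def)
  then have "((int (js i) * int m - int i) + int j * int m) mod int k = (int j * int m) mod int k"
    by (metis add_0 mod_add_left_eq)
  then show ?thesis by (simp add: gdir_def algebra_simps)
qed

lemma gdir_Suc_js_add: "gdir (Suc i) (js i + j) = int i + gdir (Suc 0) j"
  by (auto simp: gdir_Suc gdir_js_add)

lemma gdir_periodic: "gdir i (k + l) = gdir i l"
proof -
  have "(int l * int m - int i + int k * int m) mod int k = (int l * int m - int i) mod int k"
    by (metis mod_mult_self2)
  then show ?thesis by (simp add: gdir_def algebra_simps)
qed

lemma gdir_add_k: "gdir (i + k) l = gdir i l + int k"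
proof -
  have "(int l * int m - int i - int k) mod int k = (int l * int m - int i) mod int k"
    by (metis minus_mod_self2)
  then show ?thesis by (simp add: gdir_def algebra_simps)
qed

lemma js_0: "js 0 = 0"
  unfolding js_def by (rule Least_equality) (auto simp: gdir_0)

lemma js_add_k: "js (i + k) = js i"
  by (simp add: js_def gdir_add_k)

text \<open>Before the attachment index the shift of the window changes nothing; from there on it
  yields the upper boundary of the new wedge, as in the recursion. The index is shifted because
  \<open>front k m i\<close> already includes wedge \<open>i\<close>.\<close>

lemma front_eq: "front k m i = gdir (Suc i)"
proof (induction i)
  case 0
  then show ?case by (simp add: fun_eq_iff gdir_1)
next
  case (Suc i)
  have "(LEAST j. front k m i j = int (Suc i)) = js (Suc i)" by (simp only: Suc js_def)
  then have "front k m (Suc i) =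
      (\<lambda>j. if j < js (Suc i) then gdir (Suc i) j else u0 k m (j - js (Suc i)) + int (Suc i))"
    by (simp only: front.simps Let_def Suc)
  moreover have "u0 k m (j - js (Suc i)) + int (Suc i) = gdir (Suc (Suc i)) j" if "\<not> j < js (Suc i)" for j
    using gdir_Suc_js_add[of "Suc i" "j - js (Suc i)"] that by (simp add: gdir_1)
  ultimately show ?case using gdir_less_js[of _ "Suc i"] by (auto simp: fun_eq_iff)
qed

lemma wedge_shift_eq: "wedge_shift n k m i = F i (js i)"
proof (cases i)
  case 0
  then show ?thesis by (simp add: wedge_shift_def js_0 F_def)
next
  case (Suc l)
  then show ?thesis by (simp add: wedge_shift_def jstar_def front_eq F_def js_def)
qed

section \<open>Vertices of the fronts\<close>

lemma F_0 [simp]: "F i 0 = 0"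
  by (simp add: F_def)

lemma F_js_add: "F i (js i + j) = v (int i) * F 0 j + F i (js i)"
  unfolding F_def sum_lessThan_add by (simp add: gdir_js_add vdir_add sum_distrib_left)

lemma F_Suc_js: "j \<le> js i \<Longrightarrow> F (Suc i) j = F i j"
  unfolding F_def by (intro sum.cong) (auto simp: gdir_less_js)

lemma F_Suc_js_add: "F (Suc i) (js i + j) = v (int i) * F (Suc 0) j + F i (js i)"
proof -
  have "F (Suc i) (js i + j) = F (Suc i) (js i) + v (int i) * F (Suc 0) j"
    unfolding F_def sum_lessThan_add by (simp add: gdir_Suc_js_add vdir_add sum_distrib_left)
  then show ?thesis by (simp add: F_Suc_js)
qed

lemma F_periodic: "F i (k * r + j) = of_nat r * F i k + F i j"
proof (induction r)
  case (Suc r)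
  have "F i (k + l) = F i k + F i l" for l
    unfolding F_def sum_lessThan_add by (simp add: gdir_periodic)
  from this[of "k * r + j"] Suc show ?case by (simp add: algebra_simps)
qed simp

lemma F_add_k: "F (i + k) j = v (int k) * F i j"
  unfolding F_def gdir_add_k vdir_add by (simp add: sum_distrib_left mult.commute)

lemma curve_low_eq_F: "j \<le> k \<Longrightarrow> curve_pt n P (proto_low k m) j = P + F 0 j"
  unfolding curve_pt_def F_def by (auto simp: proto_low_def gdir_0 intro!: sum.cong)

lemma curve_up_eq_F:
  assumes "j \<le> k"
  shows "curve_pt n P (proto_up k m) j = P + F (Suc 0) j"
proof -
  have "proto_up k m l = gdir (Suc 0) l" if "l < k" for l
    using that mult_mod_k_eq_0[of l] by (auto simp: proto_up_def proto_low_def gdir_1 u0_def dest: dvd_imp_le)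
  then show ?thesis using assms unfolding curve_pt_def F_def by (auto intro!: sum.cong)
qed

lemma F_0_k: "F 0 k = d0"
  unfolding F_def wd0_def by (auto simp: proto_low_def gdir_0 intro!: sum.cong)

lemma F_1_eq: "1 \<le> j \<Longrightarrow> j \<le> k \<Longrightarrow> F (Suc 0) j = F 0 j + d1"
  using curve_up_eq_low[of j 0] by (simp add: curve_low_eq_F curve_up_eq_F)

lemma F_1_k: "F (Suc 0) k = d0 + d1"
  using F_1_eq[of k] k_ge2 by (simp add: F_0_k)

text \<open>The vertex with index k + js i is computed in two ways: by periodicity and as a point of
  the rotated base.\<close>

lemma F_k: "F i k = v (int i) * d0"
proof -
  have "F i (k * 1 + js i) = F i k + F i (js i)" by (subst F_periodic) simp
  moreover have "F i (js i + k) = v (int i) * d0 + F i (js i)" by (simp add: F_js_add F_0_k)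
  ultimately show ?thesis by (simp add: add.commute)
qed

lemma d0_eq: "d0 = (\<Sum>s<k. v (int s))"
proof -
  have "(\<Sum>j<k. v (int ((j * m) mod k))) = (\<Sum>s<k. v (int s))"
    by (rule sum.reindex_bij_betw[OF bij_betw_mult_mod])
  then show ?thesis by (simp add: wd0_def proto_low_def)
qed

text \<open>The periods of the two boundaries of wedge 0 differ by a rotation through 2 * pi / n,
  the opening angle of the wedge.\<close>

lemma d0_plus_d1: "d0 + d1 = v 1 * d0"
  using F_k[of "Suc 0"] F_1_k by simp

lemma Re_cnj_e_d0: "0 < Re (cnj e * d0)"
proof -
  have eq: "Re (cnj e * d0) = (\<Sum>s<k. Re (cnj e * v (int s)))"
    unfolding d0_eq sum_distrib_left Re_sum ..
  show ?thesis unfolding eq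
    using k_ge2 by (intro sum_pos2[of _ 1] Re_cnj_e_v_nonneg Re_cnj_e_v_pos) auto
qed

end

section \<open>Angle sums over a wedge\<close>

context krinkle
begin

definition path_angle :: "nat \<Rightarrow> complex \<Rightarrow> nat \<Rightarrow> real" where
  "path_angle i z N = (\<Sum>j<N. ang z (F i j) (F i (Suc j)))"

definition wedge_angle :: "nat \<Rightarrow> complex \<Rightarrow> real" where
  "wedge_angle R z = (\<Sum>r<R. \<Sum>c\<le>r. proto_angle n k m (of_nat r * d0 + of_nat c * d1) z)"

text \<open>The zigzag that bounds the first \<open>R\<close> rows of wedge 0 on the outer side.\<close>
definition zigzag_angle :: "nat \<Rightarrow> complex \<Rightarrow> real" where
  "zigzag_angle R z = (\<Sum>c<R.
     ang z (of_nat R * d0 + of_nat c * d1) (of_nat R * d0 + of_nat c * d1 + v (int k)) -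
     ang z (of_nat R * d0 + of_nat (Suc c) * d1) (of_nat R * d0 + of_nat (Suc c) * d1 + v 0))"

lemma path_angle_add:
  "path_angle i z (M + N) = path_angle i z M + (\<Sum>j<N. ang z (F i (M + j)) (F i (M + Suc j)))"
  unfolding path_angle_def sum_lessThan_add by simp

text \<open>Induction on the rows. Within a row neighbouring tiles share a path, so only the
  outermost paths survive; the bottom edges of the row cancel the zigzag of the rows below and its
  top edges form the new one.\<close>

lemma wedge_angle_eq:
  "wedge_angle R z = path_angle 0 z (k * R) - path_angle (Suc 0) z (k * R) + zigzag_angle R z"
proof (induction R)
  case 0
  then show ?case by (simp add: wedge_angle_def path_angle_def zigzag_angle_def)
next
  case (Suc r)
  \<comment> \<open>\<open>A\<close> and \<open>B\<close> are the lower and upper path without their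
    last edges; \<open>a\<close> and \<open>b\<close> are single edges in the directions 0 and
    k.\<close>
  define A where "A = (\<lambda>P. \<Sum>j<k. ang z (P + F 0 j) (P + F 0 (Suc j)))"
  define B where "B = (\<lambda>P. \<Sum>j<k. ang z (P + F (Suc 0) j) (P + F (Suc 0) (Suc j)))"
  define a where "a = (\<lambda>P. ang z P (P + v 0))"
  define b where "b = (\<lambda>P. ang z P (P + v (int k)))"
  define q where "q = (\<lambda>c. of_nat r * d0 + of_nat c * d1)"
  have proto: "proto_angle n k m P z = A P + b (P + d0) - (B P + a (P + d0 + d1))" for P
  proof -
    have "{..k} = {..<Suc k}" by auto
    moreover have "(\<Sum>j<k. ang z (curve_pt n P (proto_low k m) j) (curve_pt n P (proto_low k m) (Suc j))) = A P"
      unfolding A_def by (intro sum.cong) (auto simp: curve_low_eq_F)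
    moreover have "(\<Sum>j<k. ang z (curve_pt n P (proto_up k m) j) (curve_pt n P (proto_up k m) (Suc j))) = B P"
      unfolding B_def by (intro sum.cong) (auto simp: curve_up_eq_F)
    moreover have "ang z (curve_pt n P (proto_low k m) k) (curve_pt n P (proto_low k m) (Suc k)) = b (P + d0)"
      by (simp add: curve_pt_Suc curve_low_eq_F F_0_k b_def proto_low_def)
    moreover have "ang z (curve_pt n P (proto_up k m) k) (curve_pt n P (proto_up k m) (Suc k)) = a (P + d0 + d1)"
      using k_ge2 by (simp add: curve_pt_Suc curve_up_eq_F F_1_k a_def proto_up_def add.assoc)
    ultimately show ?thesis by (simp add: proto_angle_def)
  qed
  obtain k' where k': "k = Suc k'" using k_ge2 by (cases k) auto
  \<comment> \<open>Apart from their first edges, the upper path from \<open>P\<close> and the lower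
    path from \<open>P + d1\<close> coincide.\<close>
  have BA: "B P = b P + A (P + d1) - a (P + d1)" for P
  proof -
    have "F 0 (Suc 0) = v 0" by (simp add: F_def gdir_0)
    moreover have "F (Suc 0) (Suc 0) = v (int k)" by (simp add: F_def gdir_1 u0_def)
    moreover have "(\<Sum>j<k'. ang z (P + F (Suc 0) (Suc j)) (P + F (Suc 0) (Suc (Suc j)))) =
        (\<Sum>j<k'. ang z (P + d1 + F 0 (Suc j)) (P + d1 + F 0 (Suc (Suc j))))"
    proof (intro sum.cong refl)
      fix j assume "j \<in> {..<k'}"
      then have "Suc j \<le> k" "Suc (Suc j) \<le> k" using k' by auto
      then have "F (Suc 0) (Suc j) = F 0 (Suc j) + d1" "F (Suc 0) (Suc (Suc j)) = F 0 (Suc (Suc j)) + d1"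
        by (auto intro: F_1_eq)
      then show "ang z (P + F (Suc 0) (Suc j)) (P + F (Suc 0) (Suc (Suc j))) =
          ang z (P + d1 + F 0 (Suc j)) (P + d1 + F 0 (Suc (Suc j)))" by (simp add: add_ac)
    qed
    moreover have "(\<Sum>j<k. f j) = f 0 + (\<Sum>j<k'. f (Suc j))" for f :: "nat \<Rightarrow> real"
      using sum.lessThan_Suc_shift[of f k'] by (simp only: k')
    ultimately show ?thesis
      by (simp add: A_def B_def a_def b_def del: vdir_0)
  qed
  have q: "q c + d1 = q (Suc c)" for c by (simp add: q_def algebra_simps)
  have zig_r: "zigzag_angle r z = (\<Sum>c<r. b (q c) - a (q (Suc c)))"
    by (simp add: zigzag_angle_def a_def b_def q_def)
  have zig_Suc: "zigzag_angle (Suc r) z = (\<Sum>c\<le>r. b (q c + d0) - a (q c + d0 + d1))"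
    unfolding zigzag_angle_def lessThan_Suc_atMost
    by (intro sum.cong) (simp_all add: a_def b_def q_def algebra_simps)
  have "(\<Sum>c\<le>r. proto_angle n k m (q c) z) =
      (\<Sum>c\<le>r. A (q c) - A (q (Suc c))) - (\<Sum>c\<le>r. b (q c) - a (q (Suc c))) + zigzag_angle (Suc r) z"
    unfolding zig_Suc by (simp add: proto BA q sum.distrib sum_subtractf)
  also have "(\<Sum>c\<le>r. A (q c) - A (q (Suc c))) = A (q 0) - A (q (Suc r))" by (rule sum_telescope)
  also have "(\<Sum>c\<le>r. b (q c) - a (q (Suc c))) = zigzag_angle r z + (b (q r) - a (q (Suc r)))"
    unfolding zig_r lessThan_Suc_atMost[symmetric] by simp
  finally have row: "(\<Sum>c\<le>r. proto_angle n k m (q c) z) =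
      A (q 0) - B (q r) + zigzag_angle (Suc r) z - zigzag_angle r z"
    using BA[of "q r"] by (simp add: q)
  have kS: "k * Suc r = k * r + k" by simp
  have "path_angle 0 z (k * Suc r) = path_angle 0 z (k * r) + A (q 0)"
    unfolding kS path_angle_add F_periodic F_0_k by (simp add: A_def q_def)
  moreover have "path_angle (Suc 0) z (k * Suc r) = path_angle (Suc 0) z (k * r) + B (q r)"
    unfolding kS path_angle_add F_periodic F_1_k distrib_left by (simp add: B_def q_def)
  moreover have "wedge_angle (Suc r) z = wedge_angle r z + (\<Sum>c\<le>r. proto_angle n k m (q c) z)"
    by (simp add: wedge_angle_def q_def)
  ultimately show ?case using Suc row by simp
qed

section \<open>Limits as the number of rows grows\<close>

lemma half_plane_not_nonpos:
  assumes "p \<in> closed_segment a b" "0 < Re (cnj e * (a - z))" "0 < Re (cnj e * (b - z))"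
  shows "cnj e * (p - z) \<notin> \<real>\<^sub>\<le>\<^sub>0"
proof -
  obtain s where s: "0 \<le> s" "s \<le> 1" "p = (1 - s) *\<^sub>R a + s *\<^sub>R b"
    using assms(1) unfolding in_segment by blast
  have "cnj e * (p - z) = (1 - s) *\<^sub>R (cnj e * (a - z)) + s *\<^sub>R (cnj e * (b - z))"
    unfolding s(3) by (simp add: scaleR_conv_of_real algebra_simps)
  then have "Re (cnj e * (p - z)) = (1 - s) * Re (cnj e * (a - z)) + s * Re (cnj e * (b - z))" by simp
  also have "\<dots> > 0"
  proof (cases "s = 0")
    case False
    then show ?thesis using s assms by (intro add_nonneg_pos mult_nonneg_nonneg mult_pos_pos) auto
  qed (use assms in auto)
  finally show ?thesis by (auto simp: complex_nonpos_Reals_iff)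
qed

lemma Re_row_start: "Re (cnj e * (of_nat R * d0 + of_nat c * d1)) = real R * Re (cnj e * d0)"
proof -
  have "cnj e * (of_nat R * d0 + of_nat c * d1) = real R *\<^sub>R (cnj e * d0) + real c *\<^sub>R (cnj e * d1)"
    by (simp add: scaleR_conv_of_real algebra_simps)
  then show ?thesis using Re_cnj_e_d1 by simp
qed

text \<open>Once the zigzag lies beyond \<open>z\<close> in direction \<open>e\<close>, a branch cut
  in direction \<open>-e\<close> misses it, and the arguments telescope.\<close>

lemma zigzag_angle_eq:
  assumes "Re (cnj e * z) < real R * Re (cnj e * d0)"
  shows "zigzag_angle R z =
    Arg (cnj e * (of_nat R * (d0 + d1) - z)) - Arg (cnj e * (of_nat R * d0 - z))"
proof -
  define h where "h = (\<lambda>p. Arg (cnj e * (p - z)))"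
  define q where "q = (\<lambda>c. of_nat R * d0 + of_nat c * d1)"
  have pos: "0 < Re (cnj e * (q c - z))" for c
    using assms Re_row_start[of R c] unfolding right_diff_distrib q_def minus_complex.sel by linarith
  have pos': "0 < Re (cnj e * (q c + v a - z))" if "0 \<le> a" "a \<le> int k" for a c
  proof -
    have "cnj e * (q c + v a - z) = cnj e * (q c - z) + cnj e * v a" by (simp add: algebra_simps)
    then have "Re (cnj e * (q c + v a - z)) = Re (cnj e * (q c - z)) + Re (cnj e * v a)"
      by (simp only: plus_complex.sel)
    then show ?thesis using pos[of c] Re_cnj_e_v_nonneg[OF that] by linarith
  qed
  have edge: "ang z (q c) (q c + v a) = h (q c + v a) - h (q c)" if "0 \<le> a" "a \<le> int k" for a c
    unfolding h_def using half_plane_not_nonpos pos pos'[OF that] by (intro ang_eq_Arg_diff) blast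
  \<comment> \<open>The two edges of one tooth meet at its tip.\<close>
  have "q c + v (int k) = q (Suc c) + v 0" for c by (simp add: q_def wd1_def algebra_simps)
  then have "ang z (q c) (q c + v (int k)) - ang z (q (Suc c)) (q (Suc c) + v 0) = h (q (Suc c)) - h (q c)" for c
    using edge[of "int k" c] edge[of 0 "Suc c"] by simp
  then have "zigzag_angle R z = (\<Sum>c<R. h (q (Suc c)) - h (q c))"
    unfolding zigzag_angle_def q_def by simp
  also have "\<dots> = h (q R) - h (q 0)" by (rule sum_lessThan_telescope)
  finally show ?thesis by (simp add: h_def q_def algebra_simps)
qed

lemma tendsto_Arg_far:
  assumes "0 < Re (c * X)"
  shows "(\<lambda>R. Arg (c * (of_nat R * X - z))) \<longlonglongrightarrow> Arg (c * X)"
proof -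
  have "(\<lambda>R. c * (X - z * of_real (1 / real R))) \<longlonglongrightarrow> c * (X - z * of_real 0)"
    by (intro tendsto_intros lim_1_over_n)
  then have "(\<lambda>R. Arg (c * (X - z * of_real (1 / real R)))) \<longlonglongrightarrow> Arg (c * X)"
    using assms by (intro tendsto_Arg) (auto simp: complex_nonpos_Reals_iff)
  moreover have "\<forall>\<^sub>F R in sequentially. Arg (c * (X - z * of_real (1 / real R))) = Arg (c * (of_nat R * X - z))"
    using eventually_gt_at_top[of 0]
  proof eventually_elim
    case (elim R)
    have "c * (of_nat R * X - z) = of_real (real R) * (c * (X - z * of_real (1 / real R)))"
      using elim by (simp add: algebra_simps)
    then show ?case using elim by (simp only: Arg_times_of_real of_nat_0_less_iff)
  qed
  ultimately show ?thesis by (rule Lim_transform_eventually)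
qed

text \<open>A fixed segment carried off to infinity: after division by \<open>R\<close>, numerator
  and denominator both tend to \<open>D\<close>.\<close>

lemma tendsto_ang_far:
  assumes "D \<noteq> 0"
  shows "(\<lambda>R. ang z (of_nat R * D + a) (of_nat R * D + b)) \<longlonglongrightarrow> 0"
proof -
  have "(\<lambda>R. (D + (b - z) * of_real (1 / real R)) / (D + (a - z) * of_real (1 / real R))) \<longlonglongrightarrow>
      (D + (b - z) * of_real 0) / (D + (a - z) * of_real 0)"
    using assms by (intro tendsto_intros lim_1_over_n) auto
  then have "(\<lambda>R. (D + (b - z) * of_real (1 / real R)) / (D + (a - z) * of_real (1 / real R))) \<longlonglongrightarrow> 1"
    using assms by simp
  then have "(\<lambda>R. Arg ((D + (b - z) * of_real (1 / real R)) / (D + (a - z) * of_real (1 / real R)))) \<longlonglongrightarrow> Arg 1"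
    by (intro tendsto_Arg) auto
  then have lim: "(\<lambda>R. Arg ((D + (b - z) * of_real (1 / real R)) / (D + (a - z) * of_real (1 / real R)))) \<longlonglongrightarrow> 0"
    by simp
  have "\<forall>\<^sub>F R in sequentially. Arg ((D + (b - z) * of_real (1 / real R)) / (D + (a - z) * of_real (1 / real R)))
      = ang z (of_nat R * D + a) (of_nat R * D + b)"
    using eventually_gt_at_top[of 0]
  proof eventually_elim
    case (elim R)
    have "of_nat R * D + x - z = of_nat R * (D + (x - z) * of_real (1 / real R))" for x
      using elim by (simp add: field_simps)
    then show ?case using elim by (simp add: ang_def del: of_real_divide)
  qed
  with lim show ?thesis by (rule Lim_transform_eventually)
qed

lemma d0_nz: "d0 \<noteq> 0"
  using Re_cnj_e_d0 by auto

text \<open>Seen from a fixed point, the ends of the zigzag tend to the directions of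
  \<open>d0\<close> and \<open>d0 + d1\<close>, and the latter is \<open>v 1 * d0\<close>.\<close>

lemma zigzag_angle_tendsto: "(\<lambda>R. zigzag_angle R z) \<longlonglongrightarrow> 2 * pi / real n"
proof -
  have Re1: "0 < Re (cnj e * (d0 + d1))"
    using Re_cnj_e_d0 Re_cnj_e_d1 unfolding distrib_left plus_complex.sel by linarith
  have "ang 0 d0 (d0 + d1) = Arg (cnj e * (d0 + d1 - 0)) - Arg (cnj e * (d0 - 0))"
    using half_plane_not_nonpos[of _ d0 "d0 + d1" 0] Re1 Re_cnj_e_d0 by (intro ang_eq_Arg_diff) simp
  moreover have "ang 0 d0 (d0 + d1) = Arg (v 1)"
    using d0_nz by (simp add: ang_def d0_plus_d1)
  moreover have "Arg (v 1) = 2 * pi / real n"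
  proof -
    have "2 \<le> real n" using n_ge k_ge2 by linarith
    then have "2 * pi \<le> pi * real n" by simp
    then have "2 * pi / real n \<le> pi" using n_pos by (simp add: pos_divide_le_eq)
    moreover have "- pi < 2 * pi / real n" by (rule less_le_trans[of _ 0]) auto
    ultimately have "Arg (cis (2 * pi / real n)) = 2 * pi / real n" by (intro Arg_cis) auto
    then show ?thesis by (simp add: vdir_def)
  qed
  ultimately have val: "2 * pi / real n = Arg (cnj e * (d0 + d1)) - Arg (cnj e * d0)" by simp
  have "(\<lambda>R. Arg (cnj e * (of_nat R * (d0 + d1) - z)) - Arg (cnj e * (of_nat R * d0 - z)))
      \<longlonglongrightarrow> 2 * pi / real n"
    unfolding val using Re1 Re_cnj_e_d0 by (intro tendsto_diff tendsto_Arg_far)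
  moreover have "\<forall>\<^sub>F R in sequentially.
      Arg (cnj e * (of_nat R * (d0 + d1) - z)) - Arg (cnj e * (of_nat R * d0 - z)) = zigzag_angle R z"
    \<comment> \<open>Beyond this threshold row \<open>R\<close> lies past \<open>z\<close> in
      direction \<open>e\<close>.\<close>
    using eventually_gt_at_top[of "nat \<lceil>Re (cnj e * z) / Re (cnj e * d0)\<rceil>"]
  proof eventually_elim
    case (elim R)
    then have "Re (cnj e * z) / Re (cnj e * d0) < real R" by linarith
    then have "Re (cnj e * z) < real R * Re (cnj e * d0)"
      using Re_cnj_e_d0 pos_divide_less_eq by blast
    then show ?case by (rule zigzag_angle_eq[symmetric])
  qed
  ultimately show ?thesis by (rule Lim_transform_eventually)
qed

text \<open>The difference consists of \<open>j\<close> edges translated by \<open>R\<close>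
  periods.\<close>

lemma path_angle_far: "(\<lambda>R. path_angle i z (j + k * R) - path_angle i z (k * R)) \<longlonglongrightarrow> 0"
proof -
  have "path_angle i z (j + k * R) - path_angle i z (k * R) =
      (\<Sum>l<j. ang z (of_nat R * F i k + F i l) (of_nat R * F i k + F i (Suc l)))" for R
    unfolding add.commute[of j "k * R"] path_angle_add F_periodic by simp
  moreover have "(\<lambda>R. \<Sum>l<j. ang z (of_nat R * F i k + F i l) (of_nat R * F i k + F i (Suc l)))
      \<longlonglongrightarrow> (\<Sum>l<j. 0)"
    by (intro tendsto_sum tendsto_ang_far) (simp add: F_k d0_nz)
  ultimately show ?thesis by simp
qed

text \<open>Here \<open>w\<close> is \<open>z\<close> in the coordinates of wedge \<open>i\<close>.
  The boundaries of this wedge are the fronts before and after it, from \<open>js i\<close> on; the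
  \<open>js i\<close> edges before are common to both and cancel, and the surplus edges at the far
  end vanish in the limit.\<close>

lemma wedge_angle_tendsto:
  assumes z: "z = v (int i) * w + F i (js i)"
  shows "(\<lambda>R. wedge_angle R w - path_angle i z (k * R) + path_angle (Suc i) z (k * R)) \<longlonglongrightarrow> 2 * pi / real n"
proof -
  have ang: "ang w a b = ang z (v (int i) * a + F i (js i)) (v (int i) * b + F i (js i))" for a b
    unfolding z by (simp add: ang_affine)
  have "path_angle 0 w N = path_angle i z (js i + N) - path_angle i z (js i)" for N
    unfolding path_angle_add by (simp add: path_angle_def ang F_js_add del: add_Suc_right)
  moreover have "path_angle (Suc 0) w N = path_angle (Suc i) z (js i + N) - path_angle (Suc i) z (js i)" for N
    unfolding path_angle_add by (simp add: path_angle_def ang F_Suc_js_add del: add_Suc_right)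
  moreover have "path_angle (Suc i) z (js i) = path_angle i z (js i)"
    unfolding path_angle_def by (intro sum.cong) (auto simp: F_Suc_js)
  ultimately have eq: "wedge_angle R w - path_angle i z (k * R) + path_angle (Suc i) z (k * R) =
      (path_angle i z (js i + k * R) - path_angle i z (k * R)) -
      (path_angle (Suc i) z (js i + k * R) - path_angle (Suc i) z (k * R)) + zigzag_angle R w" for R
    by (simp add: wedge_angle_eq)
  have "(\<lambda>R. (path_angle i z (js i + k * R) - path_angle i z (k * R)) -
      (path_angle (Suc i) z (js i + k * R) - path_angle (Suc i) z (k * R)) + zigzag_angle R w)
      \<longlonglongrightarrow> 0 - 0 + 2 * pi / real n"
    by (intro tendsto_intros path_angle_far zigzag_angle_tendsto)
  then show ?thesis unfolding eq by simp
qed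

end

section \<open>From angle sums to tilings\<close>

text \<open>Points off all boundaries are dense and lie in exactly one tile. Near \<open>z\<close>
  only finitely many closed tiles matter, so their union contains \<open>z\<close> as a limit of
  such points; overlapping interiors would contain such a point in two tiles.\<close>

lemma tiles_planeI:
  fixes T B :: "'i \<Rightarrow> complex set" and J :: "nat \<Rightarrow> 'i set"
  assumes "countable I"
    and J: "\<And>R. finite (J R)" "\<And>R. J R \<subseteq> I" "\<And>x. x \<in> I \<Longrightarrow> \<forall>\<^sub>F R in sequentially. x \<in> J R"
    and neg: "\<And>x. x \<in> I \<Longrightarrow> negligible (B x)"
    and closed: "\<And>x. x \<in> I \<Longrightarrow> closed (T x)"
    and lim: "\<And>z. (\<And>x. x \<in> I \<Longrightarrow> z \<notin> B x) \<Longrightarrow> (\<lambda>R. real (card {x \<in> J R. z \<in> T x})) \<longlonglongrightarrow> 1"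
    and locfin: "\<And>z. \<exists>R. \<forall>x\<in>I - J R. T x \<inter> ball z 1 = {}"
  shows "tiles_plane T I"
proof -
  have neg': "negligible (\<Union>x\<in>I. B x)"
    using assms(1) neg by (intro negligible_countable_Union) auto
  have generic: "\<exists>z\<in>S. \<forall>x\<in>I. z \<notin> B x" if "open S" "S \<noteq> {}" for S
    using open_not_negligible[OF that] negligible_subset[OF neg', of S] by blast
  have "z \<in> (\<Union>x\<in>I. T x)" for z
  proof -
    obtain R where R: "\<forall>x\<in>I - J R. T x \<inter> ball z 1 = {}" using locfin by blast
    let ?K = "\<Union>x\<in>J R. T x"
    have "closed ?K" using J(1) closed subsetD[OF J(2)] by (intro closed_UN) auto
    have "z \<in> closure ?K"
      unfolding closure_approachable
    proof (intro allI impI)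
      fix d :: real assume "d > 0"
      then have "ball z (min d 1) \<noteq> {}" by simp
      then obtain y where y: "y \<in> ball z (min d 1)" "\<forall>x\<in>I. y \<notin> B x" using generic[of "ball z (min d 1)"] by auto
      have "\<forall>\<^sub>F R in sequentially. real (card {x \<in> J R. y \<in> T x}) > 0"
        using lim[of y] y(2) by (intro order_tendstoD) auto
      then obtain R' where "real (card {x \<in> J R'. y \<in> T x}) > 0"
        by (auto simp: eventually_sequentially)
      then have "{x \<in> J R'. y \<in> T x} \<noteq> {}" by (auto simp: card_gt_0_iff)
      then obtain x where x: "x \<in> I" "y \<in> T x" using J(2) by blast
      have "y \<in> T x \<inter> ball z 1" using x y by auto
      then have "x \<in> J R" using R x(1) by blast
      then show "\<exists>y\<in>?K. dist y z < d" using x y(1) by (auto simp: dist_commute)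
    qed
    then show ?thesis using \<open>closed ?K\<close> J(2) by (auto simp: closure_closed)
  qed
  moreover have "interior (T x) \<inter> interior (T y) = {}" if xy: "x \<in> I" "y \<in> I" "x \<noteq> y" for x y
  proof (rule ccontr)
    assume "interior (T x) \<inter> interior (T y) \<noteq> {}"
    then obtain z where z: "z \<in> interior (T x) \<inter> interior (T y)" "\<forall>x\<in>I. z \<notin> B x"
      using generic[of "interior (T x) \<inter> interior (T y)"] by auto
    then have zT: "z \<in> T x" "z \<in> T y" using interior_subset by blast+
    have "\<forall>\<^sub>F R in sequentially. real (card {x \<in> J R. z \<in> T x}) < 2"
      using lim[of z] z(2) by (intro order_tendstoD) auto
    with J(3)[OF xy(1)] J(3)[OF xy(2)]
    have "\<forall>\<^sub>F R in sequentially. False"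
    proof eventually_elim
      case (elim R)
      have "card {x, y} \<le> card {x \<in> J R. z \<in> T x}"
        using elim zT J(1)[of R] by (intro card_mono) auto
      then show ?case using elim xy(3) by simp
    qed
    then show False by simp
  qed
  ultimately show ?thesis unfolding tiles_plane_def by auto
qed

text \<open>Each tile that contains a point \<open>z\<close> off all the boundaries contributes a full turn to the
  angle sum, so a total of \<open>2 * pi\<close> means that exactly one tile contains \<open>z\<close>.\<close>
lemma tiles_plane_wedgesI:
  fixes T B :: "nat \<times> nat \<times> nat \<times> nat \<Rightarrow> complex set" and Q w :: nat
  defines "I \<equiv> {(q, i, r, c). q < Q \<and> i < w \<and> c \<le> r}"
  assumes neg: "\<And>q i r c. q < Q \<Longrightarrow> i < w \<Longrightarrow> c \<le> r \<Longrightarrow> negligible (B (q, i, r, c))"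
    and closed: "\<And>q i r c. q < Q \<Longrightarrow> i < w \<Longrightarrow> c \<le> r \<Longrightarrow> closed (T (q, i, r, c))"
    and lim: "\<And>z. (\<And>q i r c. q < Q \<Longrightarrow> i < w \<Longrightarrow> c \<le> r \<Longrightarrow> z \<notin> B (q, i, r, c)) \<Longrightarrow>
        (\<lambda>R. \<Sum>q<Q. \<Sum>i<w. \<Sum>r<R. \<Sum>c\<le>r. if z \<in> T (q, i, r, c) then 2 * pi else 0) \<longlonglongrightarrow> 2 * pi"
    and locfin: "\<And>q i z. q < Q \<Longrightarrow> i < w \<Longrightarrow> \<exists>R. \<forall>r\<ge>R. \<forall>c. T (q, i, r, c) \<inter> ball z 1 = {}"
  shows "tiles_plane T I"
proof -
  define J where "J = (\<lambda>R. Sigma {..<Q} (\<lambda>_. Sigma {..<w} (\<lambda>_. Sigma {..<R} (\<lambda>r. {..r::nat}))))"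
  have J: "J R = {(q, i, r, c). q < Q \<and> i < w \<and> r < R \<and> c \<le> r}" for R by (auto simp: J_def)
  have fin: "finite (J R)" for R by (auto simp: J_def)
  show ?thesis
  proof (rule tiles_planeI[where J = J and B = B])
    show "countable I" by simp
    show "J R \<subseteq> I" for R by (auto simp: J I_def)
    show "\<forall>\<^sub>F R in sequentially. x \<in> J R" if "x \<in> I" for x
      using eventually_gt_at_top[of "fst (snd (snd x))"]
      by eventually_elim (use that in \<open>auto simp: J I_def\<close>)
    show "(\<lambda>R. real (card {x \<in> J R. z \<in> T x})) \<longlonglongrightarrow> 1" if z: "\<And>x. x \<in> I \<Longrightarrow> z \<notin> B x" for z
    proof -
      have "(\<lambda>R. \<Sum>q<Q. \<Sum>i<w. \<Sum>r<R. \<Sum>c\<le>r. if z \<in> T (q, i, r, c) then 2 * pi else 0) \<longlonglongrightarrow> 2 * pi"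
        using z by (intro lim) (auto simp: I_def)
      moreover have "(\<Sum>q<Q. \<Sum>i<w. \<Sum>r<R. \<Sum>c\<le>r. if z \<in> T (q, i, r, c) then 2 * pi else 0) =
          2 * pi * real (card {x \<in> J R. z \<in> T x})" for R
      proof -
        have "(\<Sum>q<Q. \<Sum>i<w. \<Sum>r<R. \<Sum>c\<le>r. if z \<in> T (q, i, r, c) then 2 * pi else 0) =
            (\<Sum>x\<in>J R. if z \<in> T x then 2 * pi else 0)"
          unfolding J_def by (simp add: sum.Sigma split_def)
        also have "\<dots> = (\<Sum>x\<in>{x \<in> J R. z \<in> T x}. 2 * pi)"
          by (rule sum.inter_filter[OF fin, symmetric])
        finally show ?thesis by simp
      qed
      ultimately have "(\<lambda>R. 2 * pi * real (card {x \<in> J R. z \<in> T x}) / (2 * pi)) \<longlonglongrightarrow> 2 * pi / (2 * pi)"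
        by (intro tendsto_divide tendsto_const) auto
      then show ?thesis by simp
    qed
    show "\<exists>R. \<forall>x\<in>I - J R. T x \<inter> ball z 1 = {}" for z
    proof -
      have "\<forall>q i. \<exists>R. q < Q \<longrightarrow> i < w \<longrightarrow> (\<forall>r\<ge>R. \<forall>c. T (q, i, r, c) \<inter> ball z 1 = {})"
        using locfin by blast
      then obtain \<rho> where \<rho>: "\<And>q i r c. q < Q \<Longrightarrow> i < w \<Longrightarrow> r \<ge> \<rho> q i \<Longrightarrow> T (q, i, r, c) \<inter> ball z 1 = {}"
        by metis
      \<comment> \<open>The sum bounds all of the finitely many thresholds at once.\<close>
      define R where "R = (\<Sum>q<Q. \<Sum>i<w. \<rho> q i)"
      have "\<rho> q i \<le> R" if "q < Q" "i < w" for q i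
      proof -
        have "\<rho> q i \<le> (\<Sum>i<w. \<rho> q i)" using that by (intro member_le_sum) auto
        also have "\<dots> \<le> R" unfolding R_def using that by (intro member_le_sum[of q "{..<Q}" "\<lambda>q. \<Sum>i<w. \<rho> q i"]) auto
        finally show ?thesis .
      qed
      note le = this
      have "T x \<inter> ball z 1 = {}" if "x \<in> I - J R" for x
      proof -
        obtain q i r c where x: "x = (q, i, r, c)" by (cases x)
        then have "q < Q" "i < w" "R \<le> r" using that by (auto simp: I_def J)
        then show ?thesis unfolding x using le[of q i] by (intro \<rho>) auto
      qed
      then show ?thesis by blast
    qed
  qed (use neg closed fin in \<open>auto simp: I_def\<close>)
qed

section \<open>Tiles of the rotated wedges\<close>

lemma negligible_affine_image:
  fixes S :: "complex set"
  assumes "negligible S"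
  shows "negligible ((\<lambda>z. a * z + b) ` S)"
  using assms
  by (intro negligible_differentiable_image_negligible differentiable_on_add differentiable_on_mult
      differentiable_on_const differentiable_on_id) auto

lemma closed_affine_image:
  fixes S :: "complex set"
  assumes "closed S"
  shows "closed ((\<lambda>z. a * z + b) ` S)"
proof (cases "a = 0")
  case False
  have "closed ((+) b ` (*) a ` S)"
    using assms False by (intro closed_translation closed_injective_linear_image)
      (auto simp: linear_times inj_on_def)
  then show ?thesis by (simp add: image_image add.commute)
next
  case True
  then have "(\<lambda>z. a * z + b) ` S \<subseteq> {b}" by auto
  then show ?thesis by (intro finite_imp_closed) (auto intro: finite_subset)
qed

context krinkle
begin

definition pull :: "nat \<Rightarrow> complex \<Rightarrow> complex" where
  "pull i z = (z - F i (js i)) / v (int i)"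

text \<open>Makes sense for every \<open>i\<close>, so that rotated copies of the first
  \<open>k\<close> wedges are simply later wedges.\<close>

definition gtile :: "nat \<Rightarrow> nat \<Rightarrow> nat \<Rightarrow> complex set" where
  "gtile i r c = (\<lambda>z. v (int i) * z + F i (js i)) ` prototile n k m (of_nat r * d0 + of_nat c * d1)"

definition gbound :: "nat \<Rightarrow> nat \<Rightarrow> nat \<Rightarrow> complex set" where
  "gbound i r c = (\<lambda>z. v (int i) * z + F i (js i)) ` proto_boundary n k m (of_nat r * d0 + of_nat c * d1)"

lemma pull: "v (int i) * pull i z + F i (js i) = z" and pull': "pull i (v (int i) * w + F i (js i)) = w"
  by (simp_all add: pull_def)

lemma in_gtile_iff: "z \<in> gtile i r c \<longleftrightarrow> pull i z \<in> prototile n k m (of_nat r * d0 + of_nat c * d1)"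
  unfolding gtile_def by (metis (no_types, lifting) image_iff pull pull')

lemma in_gbound_iff: "z \<in> gbound i r c \<longleftrightarrow> pull i z \<in> proto_boundary n k m (of_nat r * d0 + of_nat c * d1)"
  unfolding gbound_def by (metis (no_types, lifting) image_iff pull pull')

lemma closed_gtile: "closed (gtile i r c)"
  unfolding gtile_def by (intro closed_affine_image closed_prototile)

lemma negligible_gbound: "negligible (gbound i r c)"
  unfolding gbound_def by (intro negligible_affine_image negligible_proto_boundary)

lemma wedge_tile_eq: "wedge_tile n k m i r c = gtile i r c"
  unfolding wedge_tile_def gtile_def wedge_shift_eq by (simp add: vdir_def)

text \<open>No edge points backwards with respect to \<open>e\<close>, so the boundary lies in this
  half-plane; by convexity so does its inside.\<close>

lemma prototile_half_plane:
  assumes "p \<in> prototile n k m P"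
  shows "Re (cnj e * P) \<le> Re (cnj e * p)"
proof -
  let ?H = "{x. inner e x \<ge> inner e P}"
  have in_e: "Re (cnj e * x) = inner e x" for x by (simp add: inner_complex_def)
  have step: "inner e (curve_pt n P a j) \<ge> inner e P" if "\<And>j. 0 \<le> a j \<and> a j \<le> int k" for a j
  proof (induction j)
    case (Suc j)
    then show ?case using Re_cnj_e_v_nonneg[of "a j"] that[of j]
      unfolding curve_pt_Suc inner_add_right in_e by linarith
  qed simp
  have conv: "convex ?H" by (rule convex_halfspace_ge)
  have low: "curve_pt n P (proto_low k m) j \<in> ?H" for j
    using step[of "proto_low k m" j] proto_low_bounds by auto
  have up: "curve_pt n P (proto_up k m) j \<in> ?H" for j
    using step[of "proto_up k m" j] proto_low_bounds by (auto simp: proto_up_def)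
  have "proto_boundary n k m P \<subseteq> ?H"
    unfolding proto_boundary_def
    using closed_segment_subset[OF low low conv] closed_segment_subset[OF up up conv] by blast
  then have "- ?H \<subseteq> outside (proto_boundary n k m P)" using conv outside_subset_convex by blast
  then have "p \<in> ?H" using assms unfolding prototile_def union_with_inside by blast
  then show ?thesis unfolding in_e by simp
qed

text \<open>Row \<open>r\<close> of wedge 0 has height at least \<open>r * Re (cnj e * d0)\<close>
  in direction \<open>e\<close>, which tends to infinity.\<close>

lemma gtile_locally_finite: "\<exists>R. \<forall>r\<ge>R. \<forall>c. gtile i r c \<inter> ball z 1 = {}"
proof -
  let ?\<delta> = "Re (cnj e * d0)" and ?M = "norm z + 1 + norm (F i (js i))"
  \<comment> \<open>\<open>?M\<close> bounds the distance from the apex of the wedge to the points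
    of the ball.\<close>
  define R where "R = nat \<lceil>?M / ?\<delta>\<rceil> + 1"
  have "gtile i r c \<inter> ball z 1 = {}" if "r \<ge> R" for r c
  proof (rule ccontr)
    assume "\<not> ?thesis"
    then obtain y where y: "y \<in> gtile i r c" "dist z y < 1" by auto
    let ?p = "pull i y"
    have "Re (cnj e * (of_nat r * d0 + of_nat c * d1)) \<le> Re (cnj e * ?p)"
      using y by (intro prototile_half_plane) (simp add: in_gtile_iff)
    then have "real r * ?\<delta> \<le> Re (cnj e * ?p)" unfolding Re_row_start .
    also have "\<dots> \<le> norm (cnj e * ?p)" by (rule complex_Re_le_cmod)
    also have "\<dots> = norm (y - F i (js i))" by (simp add: norm_mult pull_def norm_divide)
    also have "\<dots> \<le> norm y + norm (F i (js i))" by (rule norm_triangle_ineq4)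
    also have "\<dots> \<le> ?M" using y(2) norm_triangle_ineq2[of y z] by (simp add: dist_norm norm_minus_commute)
    finally have "real r \<le> ?M / ?\<delta>" using Re_cnj_e_d0 by (simp only: pos_le_divide_eq)
    moreover have "real r > ?M / ?\<delta>" using that unfolding R_def by linarith
    ultimately show False by simp
  qed
  then show ?thesis by blast
qed

definition wedge_count :: "nat \<Rightarrow> nat \<Rightarrow> complex \<Rightarrow> real" where
  "wedge_count i R z = (\<Sum>r<R. \<Sum>c\<le>r. if z \<in> gtile i r c then 2 * pi else 0)"

lemma wedge_count_eq:
  assumes "\<And>r c. c \<le> r \<Longrightarrow> z \<notin> gbound i r c"
  shows "wedge_count i R z = wedge_angle R (pull i z)"
  unfolding wedge_count_def wedge_angle_def
  using assms by (intro sum.cong refl) (simp add: proto_angle_eq in_gtile_iff in_gbound_iff)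

text \<open>The front after one wedge is the front before the next, so the path terms
  telescope.\<close>

lemma wedge_counts_tendsto:
  assumes "\<And>i r c. i < N \<Longrightarrow> c \<le> r \<Longrightarrow> z \<notin> gbound i r c"
  shows "(\<lambda>R. (\<Sum>i<N. wedge_count i R z) - path_angle 0 z (k * R) + path_angle N z (k * R))
    \<longlonglongrightarrow> real N * (2 * pi / real n)"
proof -
  have "(\<lambda>R. \<Sum>i<N. wedge_count i R z - path_angle i z (k * R) + path_angle (Suc i) z (k * R))
      \<longlonglongrightarrow> (\<Sum>i<N. 2 * pi / real n)"
  proof (rule tendsto_sum)
    fix i assume i: "i \<in> {..<N}"
    have "(\<lambda>R. wedge_angle R (pull i z) - path_angle i z (k * R) + path_angle (Suc i) z (k * R)) \<longlonglongrightarrow> 2 * pi / real n"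
      by (rule wedge_angle_tendsto) (simp add: pull)
    then show "(\<lambda>R. wedge_count i R z - path_angle i z (k * R) + path_angle (Suc i) z (k * R)) \<longlonglongrightarrow> 2 * pi / real n"
      using wedge_count_eq[of z i] assms i by simp
  qed
  moreover have "(\<Sum>i<N. wedge_count i R z - path_angle i z (k * R) + path_angle (Suc i) z (k * R)) =
      (\<Sum>i<N. wedge_count i R z) - path_angle 0 z (k * R) + path_angle N z (k * R)" for R
    using sum_lessThan_telescope[of "\<lambda>i. path_angle i z (k * R)" N]
    by (simp add: sum.distrib sum_subtractf)
  ultimately show ?thesis by simp
qed

end

section \<open>The two tilings\<close>

context krinkle
begin

lemma F_add_mult_k: "F (q * k + i) j = v (int (q * k)) * F i j"
proof (induction q)
  case (Suc q)
  have "F (Suc q * k + i) j = F (q * k + i + k) j" by (simp add: algebra_simps)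
  then show ?case using Suc by (simp add: F_add_k vdir_add)
qed simp

lemma js_add_mult_k: "js (q * k + i) = js i"
proof (induction q)
  case (Suc q)
  have "js (Suc q * k + i) = js (q * k + i + k)" by (simp add: algebra_simps)
  then show ?case using Suc by (simp add: js_add_k)
qed simp

text \<open>Raising the window by \<open>k\<close> rotates the front by \<open>v (int k)\<close> and
  keeps the attachment index.\<close>

lemma rotated_gtile: "(\<lambda>z. v (int (q * k)) * z) ` gtile i r c = gtile (q * k + i) r c"
  unfolding gtile_def js_add_mult_k F_add_mult_k
  by (simp add: image_image algebra_simps vdir_add)

end

text \<open>The \<open>t\<close> copies of \<open>k\<close> wedges are the wedges 0 to n - 1, and
  after this full turn the front is the base again.\<close>

lemma tiles_plane_no_offset:
  assumes "0 < m" "m < k" "coprime m k" "2 \<le> t"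
  shows "tiles_plane (krinkle_tile_no_offset k m t) (krinkle_index_no_offset k t)"
proof -
  interpret krinkle "t * k" k m
    using assms by unfold_locales auto
  have tile: "krinkle_tile_no_offset k m t (q, i, r, c) = gtile (q * k + i) r c" for q i r c
  proof -
    have "cis (2 * pi * real q / real t) = v (int (q * k))" using assms by (simp add: vdir_def mult.assoc)
    then show ?thesis 
      by (simp only: krinkle_tile_no_offset_def split_conv wedge_tile_eq rotated_gtile)
  qed
  have grouped: "(\<Sum>q<t. \<Sum>i<k. f (q * k + i)) = (\<Sum>i<t * k. f i)" for f :: "nat \<Rightarrow> real" and t
    by (induction t) (simp_all add: sum_lessThan_add add.commute[of k])
  show ?thesis
    unfolding krinkle_index_no_offset_def
  proof (rule tiles_plane_wedgesI[where B = "\<lambda>(q, i, r, c). gbound (q * k + i) r c"], goal_cases)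
    case (3 z)
    have "z \<notin> gbound i r c" if "i < t * k" "c \<le> r" for i r c
    proof -
      have "i div k < t" "i mod k < k" using that m_less by (auto simp: less_mult_imp_div_less)
      then show ?thesis using 3[of "i div k" "i mod k" c r] that by simp
    qed
    then have "(\<lambda>R. (\<Sum>i<t * k. wedge_count i R z) - path_angle 0 z (k * R) + path_angle (t * k) z (k * R))
        \<longlonglongrightarrow> real (t * k) * (2 * pi / real (t * k))"
      by (rule wedge_counts_tendsto)
    moreover have "path_angle (t * k) z N = path_angle 0 z N" for N
    proof -
      have "v (int (t * k)) = 1" using n_pos by (simp add: vdir_def)
      then have "F (t * k) j = F 0 j" for j using F_add_mult_k[of t 0 j] by simp
      then show ?thesis by (simp add: path_angle_def)
    qed
    ultimately have "(\<lambda>R. \<Sum>i<t * k. wedge_count i R z) \<longlonglongrightarrow> 2 * pi" using n_pos by simp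
    then show ?case unfolding tile grouped[symmetric] wedge_count_def .
  qed (auto simp: tile negligible_gbound closed_gtile gtile_locally_finite)
qed

text \<open>After half a turn the front is the base without its first edge, rotated by pi about 1/2.
  Each half of the tiling contributes pi, and the paths of the two halves cancel up to the first
  base edge and one edge far away.\<close>

lemma tiles_plane_offset:
  assumes "0 < m" "m < k" "coprime m k" "2 \<le> t"
  shows "tiles_plane (krinkle_tile_offset k m t) (krinkle_index_offset k m t)"
proof -
  define w where "w = t * k - m"
  have tk: "2 * k \<le> t * k" using assms by simp
  interpret krinkle "2 * (t * k - m)" k m
  proof
    show "2 * k \<le> 2 * (t * k - m)" using tk assms(2) by linarith
  qed (use assms in auto)
  have w_pos: "0 < w" unfolding w_def using tk assms(2) by linarith
  have tile: "krinkle_tile_offset k m t (q, i, r, c) =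
      (if q = 0 then gtile i r c else (\<lambda>z. 1 - z) ` gtile i r c)" for q i r c
    by (simp add: krinkle_tile_offset_def wedge_tile_eq)
  have mirror: "z \<in> (\<lambda>z. 1 - z) ` S \<longleftrightarrow> 1 - z \<in> S" for z :: complex and S
    by (auto intro: image_eqI[of _ _ "1 - z"])
  have affine: "(\<lambda>z. 1 - z) = (\<lambda>z::complex. (-1) * z + 1)" by auto
  have ang_mirror: "ang (1 - z) (1 - a) (1 - b) = ang z a b" for z a b
    using ang_affine[of "-1" z 1 a b] by simp
  have F01: "F 0 (Suc 0) = 1" by (simp add: F_def gdir_0)
  have F_w: "F w j = 1 - F 0 (Suc j)" for j
  proof -
    \<comment> \<open>Modulo \<open>k\<close>, \<open>-w\<close> is \<open>m\<close>, which advances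
      the sequence by one index.\<close>
    have "gdir w l = int w + gdir 0 (Suc l)" for l
    proof -
      have "m \<le> t * k" using tk assms(2) by linarith
      then have "int w = int t * int k - int m" by (simp add: w_def of_nat_diff)
      then have "int l * int m - int w = int (Suc l) * int m + int k * (- int t)"
        by (simp add: algebra_simps)
      also have "\<dots> mod int k = (int (Suc l) * int m) mod int k" by (rule mod_mult_self2)
      finally show ?thesis by (simp add: gdir_def)
    qed
    moreover have "v (int w) = -1"
      unfolding vdir_def w_def[symmetric] using w_pos by simp
    ultimately have "F w j = - (\<Sum>l<j. v (gdir 0 (Suc l)))"
      by (simp add: F_def vdir_add sum_negf)
    moreover have "F 0 (Suc j) = F 0 (Suc 0) + (\<Sum>l<j. v (gdir 0 (Suc l)))"
      unfolding F_def sum.lessThan_Suc_shift by simp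
    ultimately show ?thesis by (simp add: F01)
  qed
  have path_w: "path_angle w z N = path_angle 0 (1 - z) (1 + N) - ang (1 - z) 0 1" for z N
  proof -
    have "path_angle w z N = (\<Sum>j<N. ang (1 - z) (F 0 (Suc j)) (F 0 (Suc (Suc j))))"
      unfolding path_angle_def F_w by (simp flip: ang_mirror[of z])
    then show ?thesis unfolding path_angle_def plus_1_eq_Suc sum.lessThan_Suc_shift by (simp add: F01)
  qed
  show ?thesis
    unfolding krinkle_index_offset_def w_def[symmetric]
  proof (rule tiles_plane_wedgesI[where B = "\<lambda>(q, i, r, c).
      if q = 0 then gbound i r c else (\<lambda>z. 1 - z) ` gbound i r c"], goal_cases)
    case (1 q i r c)
    have "negligible ((\<lambda>z. 1 - z) ` gbound i r c)"
      unfolding affine by (intro negligible_affine_image negligible_gbound)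
    then show ?case by (simp add: negligible_gbound)
  next
    case (2 q i r c)
    have "closed ((\<lambda>z. 1 - z) ` gtile i r c)"
      unfolding affine by (intro closed_affine_image closed_gtile)
    then show ?case by (simp add: tile closed_gtile)
  next
    case (3 z)
    have z: "z \<notin> gbound i r c" if "i < w" "c \<le> r" for i r c
      using 3[of 0 i c r] that by simp
    have z': "1 - z \<notin> gbound i r c" if "i < w" "c \<le> r" for i r c
      using 3[of 1 i c r] that by (simp add: mirror)
    \<comment> \<open>The first base edge is traversed once in each direction, and
      \<open>ang_commute\<close> requires \<open>z\<close> off it; it lies on the boundary of the
      first tile.\<close>
    have "z \<notin> closed_segment 0 1"
    proof
      assume "z \<in> closed_segment 0 1"
      then have "z \<in> closed_segment (curve_pt (2 * (t * k - m)) 0 (proto_low k m) 0)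
          (curve_pt (2 * (t * k - m)) 0 (proto_low k m) (Suc 0))"
        using m_less by (simp add: curve_pt_Suc proto_low_def)
      then have "z \<in> proto_boundary (2 * (t * k - m)) k m 0" unfolding proto_boundary_def by blast
      moreover have "pull 0 z = z" by (simp add: pull_def js_0)
      ultimately have "z \<in> gbound 0 0 0" by (simp add: in_gbound_iff)
      then show False using z[of 0 0 0] w_pos by simp
    qed
    then have ends: "ang z 0 1 + ang (1 - z) 0 1 = 0"
      using ang_mirror[of z 1 0] ang_commute[of z 0 1] by simp
    \<comment> \<open>The surplus edge at the far end, due to the shift by one index.\<close>
    let ?far = "\<lambda>z R. path_angle 0 z (1 + k * R) - path_angle 0 z (k * R)"
    have half: "real w * (2 * pi / real (2 * (t * k - m))) = pi" 
      unfolding w_def[symmetric] using w_pos by simp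
    have lim: "(\<lambda>R. ((\<Sum>i<w. wedge_count i R z) - path_angle 0 z (k * R) + path_angle w z (k * R)) +
        ((\<Sum>i<w. wedge_count i R (1 - z)) - path_angle 0 (1 - z) (k * R) + path_angle w (1 - z) (k * R)) -
        ?far z R - ?far (1 - z) R) \<longlonglongrightarrow> pi + pi - 0 - 0"
      using wedge_counts_tendsto[of w z, unfolded half] wedge_counts_tendsto[of w "1 - z", unfolded half] z z'
      by (intro tendsto_add tendsto_diff path_angle_far) blast+
    have eq: "((\<Sum>i<w. wedge_count i R z) - path_angle 0 z (k * R) + path_angle w z (k * R)) +
        ((\<Sum>i<w. wedge_count i R (1 - z)) - path_angle 0 (1 - z) (k * R) + path_angle w (1 - z) (k * R)) -
        ?far z R - ?far (1 - z) R = (\<Sum>i<w. wedge_count i R z) + (\<Sum>i<w. wedge_count i R (1 - z))" for R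
      using ends path_w[of z "k * R"] path_w[of "1 - z" "k * R"] by simp
    have "(\<lambda>R. (\<Sum>i<w. wedge_count i R z) + (\<Sum>i<w. wedge_count i R (1 - z))) \<longlonglongrightarrow> 2 * pi"
      using lim unfolding eq by simp
    moreover have "{..<2} = {0, 1::nat}" by auto
    ultimately show ?case by (simp add: tile mirror wedge_count_def)
  next
    case (4 q i z)
    obtain R where R: "\<forall>r\<ge>R. \<forall>c. gtile i r c \<inter> ball z 1 = {}" using gtile_locally_finite by blast
    obtain R' where R': "\<forall>r\<ge>R'. \<forall>c. gtile i r c \<inter> ball (1 - z) 1 = {}" using gtile_locally_finite by blast
    have "(\<lambda>z. 1 - z) ` gtile i r c \<inter> ball z 1 = {}" if "r \<ge> R'" for r c
    proof -
      have "dist (1 - z) x = dist z (1 - x)" for x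
        by (simp add: dist_norm norm_minus_commute algebra_simps)
      then show ?thesis using R' that by fastforce
    qed
    then show ?case using R by (intro exI[of _ "max R R'"]) (auto simp: tile)
  qed
qed

theorem mainTheorem1:
  fixes m k t :: nat
  assumes "0 < m" and "m < k" and "coprime m k" and "2 \<le> t"
  shows "tiles_plane (krinkle_tile_no_offset k m t) (krinkle_index_no_offset k t)
       \<and> tiles_plane (krinkle_tile_offset k m t) (krinkle_index_offset k m t)"
  using tiles_plane_no_offset[OF assms] tiles_plane_offset[OF assms] by simp

end
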